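(* Let $R$ be a commutative noetherian local ring of dimension $d$ and let $M$ be a finitely generated $R$-module of dimension $r$ and grade $g$ (with $r,g$ non-negative integers). Suppose that $\dim(\operatorname{Ext}^{d-i}_R(M,R))\leq i$ for all integers $i$ and that $g=d-r$. Then $\dim(\operatorname{Ext}^{d-r}_R(M,R))=r$.
   Context: The dimension of a finitely generated module is the Krull dimension of its support; the zero module has dimension $-\infty$, and $\operatorname{Ext}^j_R=0$ for $j<0$. The grade of $M$ is $\inf\{i:\operatorname{Ext}^i_R(M,R)\neq 0\}$. *)

theory Defs
  imports
    "HOL-Algebra.Module"
    "HOL-Algebra.Ring_Divisibility"
    "HOL-Library.Extended_Real"
begin

text \<open>
  Modules are the records of \<open>HOL-Algebra.Module\<close>. These extend the ring record, so every
  module constructed here also carries fields \<open>mult\<close> and \<open>one\<close>; they are left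
  \<open>undefined\<close> and play no role.
\<close>

locale local_ring = cring +
  assumes ex1_maximalideal: "\<exists>!I. maximalideal I R"


subsection \<open>Constructions on modules\<close>

definition ring_module :: "('a, 'x) ring_scheme \<Rightarrow> ('a, 'a) module" where
  "ring_module R = \<lparr>carrier = carrier R, mult = (\<lambda>_ _. undefined), one = undefined,
     zero = \<zero>\<^bsub>R\<^esub>, add = (\<oplus>\<^bsub>R\<^esub>), smult = (\<otimes>\<^bsub>R\<^esub>)\<rparr>"

definition zero_module :: "('a, 'm) module" where
  "zero_module = \<lparr>carrier = {undefined}, mult = (\<lambda>_ _. undefined), one = undefined,
     zero = undefined, add = (\<lambda>_ _. undefined), smult = (\<lambda>_ _. undefined)\<rparr>"

definition is_zero_module :: "('a, 'm, 'y) module_scheme \<Rightarrow> bool" where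
  "is_zero_module M \<longleftrightarrow> carrier M = {\<zero>\<^bsub>M\<^esub>}"

definition fin_gen_module :: "('a, 'x) ring_scheme \<Rightarrow> ('a, 'm, 'y) module_scheme \<Rightarrow> bool" where
  "fin_gen_module R M \<longleftrightarrow>
     (\<exists>A. finite A \<and> A \<subseteq> carrier M \<and>
          carrier M = {\<Oplus>\<^bsub>M\<^esub>a\<in>A. c a \<odot>\<^bsub>M\<^esub> a | c. c \<in> A \<rightarrow> carrier R})"

text \<open>The free module on \<open>B\<close>; elements are finitely supported and vanish outside \<open>B\<close>.\<close>

definition free_module :: "('a, 'x) ring_scheme \<Rightarrow> 'i set \<Rightarrow> ('a, 'i \<Rightarrow> 'a) module" where
  "free_module R B = \<lparr>carrier = {f. range f \<subseteq> carrier R \<and> finite {i. f i \<noteq> \<zero>\<^bsub>R\<^esub>} \<and> {i. f i \<noteq> \<zero>\<^bsub>R\<^esub>} \<subseteq> B},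
     mult = (\<lambda>_ _. undefined), one = undefined,
     zero = (\<lambda>_. \<zero>\<^bsub>R\<^esub>), add = (\<lambda>f g i. f i \<oplus>\<^bsub>R\<^esub> g i), smult = (\<lambda>a f i. a \<otimes>\<^bsub>R\<^esub> f i)\<rparr>"

text \<open>
  Linear maps are taken extensional (\<open>undefined\<close> outside the carrier of the domain), so that
  equality of functions is equality of linear maps.
\<close>

definition linear_maps ::
    "('a, 'x) ring_scheme \<Rightarrow> ('a, 'm, 'y) module_scheme \<Rightarrow> ('a, 'n, 'z) module_scheme \<Rightarrow> ('m \<Rightarrow> 'n) set" where
  "linear_maps R M N =
     {h \<in> carrier M \<rightarrow>\<^sub>E carrier N.
        (\<forall>x\<in>carrier M. \<forall>y\<in>carrier M. h (x \<oplus>\<^bsub>M\<^esub> y) = h x \<oplus>\<^bsub>N\<^esub> h y) \<and>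
        (\<forall>a\<in>carrier R. \<forall>x\<in>carrier M. h (a \<odot>\<^bsub>M\<^esub> x) = a \<odot>\<^bsub>N\<^esub> h x)}"

definition Hom ::
    "('a, 'x) ring_scheme \<Rightarrow> ('a, 'm, 'y) module_scheme \<Rightarrow> ('a, 'n, 'z) module_scheme \<Rightarrow> ('a, 'm \<Rightarrow> 'n) module" where
  "Hom R M N = \<lparr>carrier = linear_maps R M N, mult = (\<lambda>_ _. undefined), one = undefined,
     zero = (\<lambda>x\<in>carrier M. \<zero>\<^bsub>N\<^esub>),
     add = (\<lambda>f g. \<lambda>x\<in>carrier M. f x \<oplus>\<^bsub>N\<^esub> g x),
     smult = (\<lambda>a f. \<lambda>x\<in>carrier M. a \<odot>\<^bsub>N\<^esub> f x)\<rparr>"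

definition quotient_module :: "('a, 'm, 'y) module_scheme \<Rightarrow> 'm set \<Rightarrow> ('a, 'm set) module" where
  "quotient_module M H = \<lparr>carrier = a_rcosets\<^bsub>M\<^esub> H, mult = (\<lambda>_ _. undefined), one = undefined,
     zero = H, add = (<+>\<^bsub>M\<^esub>), smult = (\<lambda>a X. \<Union>x\<in>X. H +>\<^bsub>M\<^esub> (a \<odot>\<^bsub>M\<^esub> x))\<rparr>"


subsection \<open>Support and dimension\<close>

text \<open>
  The localization of \<open>M\<close> at the multiplicative set \<open>S\<close>, as an \<open>R\<close>-module: classes of pairs
  \<open>(m, s)\<close>, standing for the fractions \<open>m / s\<close>.
\<close>

definition fraction_rel ::
    "'a set \<Rightarrow> ('a, 'm, 'y) module_scheme \<Rightarrow> (('m \<times> 'a) \<times> ('m \<times> 'a)) set" where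
  "fraction_rel S M =
     {((m, s), (n, t)). m \<in> carrier M \<and> s \<in> S \<and> n \<in> carrier M \<and> t \<in> S \<and>
        (\<exists>u\<in>S. u \<odot>\<^bsub>M\<^esub> (t \<odot>\<^bsub>M\<^esub> m) = u \<odot>\<^bsub>M\<^esub> (s \<odot>\<^bsub>M\<^esub> n))}"

definition localized_module ::
    "('a, 'x) ring_scheme \<Rightarrow> 'a set \<Rightarrow> ('a, 'm, 'y) module_scheme \<Rightarrow> ('a, ('m \<times> 'a) set) module" where
  "localized_module R S M =
     \<lparr>carrier = (carrier M \<times> S) // fraction_rel S M, mult = (\<lambda>_ _. undefined), one = undefined,
      zero = fraction_rel S M `` {(\<zero>\<^bsub>M\<^esub>, \<one>\<^bsub>R\<^esub>)},
      add = (\<lambda>X Y. \<Union>(m, s)\<in>X. \<Union>(n, t)\<in>Y.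
               fraction_rel S M `` {(t \<odot>\<^bsub>M\<^esub> m \<oplus>\<^bsub>M\<^esub> s \<odot>\<^bsub>M\<^esub> n, s \<otimes>\<^bsub>R\<^esub> t)}),
      smult = (\<lambda>a X. \<Union>(m, s)\<in>X. fraction_rel S M `` {(a \<odot>\<^bsub>M\<^esub> m, s)})\<rparr>"

definition Spec :: "('a, 'x) ring_scheme \<Rightarrow> 'a set set" where
  "Spec R = {P. primeideal P R}"

definition Supp :: "('a, 'x) ring_scheme \<Rightarrow> ('a, 'm, 'y) module_scheme \<Rightarrow> 'a set set" where
  "Supp R M = {P \<in> Spec R. \<not> is_zero_module (localized_module R (carrier R - P) M)}"

text \<open>
  The Krull dimension of a set of prime ideals is the supremum of the lengths of its chains
  \<open>P 0 \<subset> \<dots> \<subset> P n\<close>. In \<open>ereal\<close> the supremum of the empty set is \<open>-\<infinity>\<close>, so the zero module gets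
  dimension \<open>-\<infinity>\<close>.
\<close>

definition krull_dim :: "'a set set \<Rightarrow> ereal" where
  "krull_dim X =
     Sup {ereal (real n) | n. \<exists>P :: nat \<Rightarrow> 'a set. (\<forall>i\<le>n. P i \<in> X) \<and> (\<forall>i<n. P i \<subset> P (Suc i))}"

definition ring_dim :: "('a, 'x) ring_scheme \<Rightarrow> ereal" where
  "ring_dim R = krull_dim (Spec R)"

definition module_dim :: "('a, 'x) ring_scheme \<Rightarrow> ('a, 'm, 'y) module_scheme \<Rightarrow> ereal" where
  "module_dim R M = krull_dim (Supp R M)"


subsection \<open>Ext and grade\<close>

text \<open>
  A free resolution \<open>\<dots> \<rightarrow> F 1 \<rightarrow> F 0 \<rightarrow> M \<rightarrow> 0\<close>, where \<open>F n\<close> is free on the set \<open>B n\<close>, with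
  differentials \<open>d n : F (n + 1) \<rightarrow> F n\<close> and augmentation \<open>e : F 0 \<rightarrow> M\<close>.
\<close>

definition free_resolution ::
    "('a, 'x) ring_scheme \<Rightarrow> ('a, 'm, 'y) module_scheme \<Rightarrow> (nat \<Rightarrow> 'i set) \<Rightarrow>
     (nat \<Rightarrow> ('i \<Rightarrow> 'a) \<Rightarrow> ('i \<Rightarrow> 'a)) \<Rightarrow> (('i \<Rightarrow> 'a) \<Rightarrow> 'm) \<Rightarrow> bool" where
  "free_resolution R M B d e \<longleftrightarrow>
     (let F = (\<lambda>n. free_module R (B n)) in
        e \<in> linear_maps R (F 0) M \<and>
        (\<forall>n. d n \<in> linear_maps R (F (Suc n)) (F n)) \<and>
        e ` carrier (F 0) = carrier M \<and>
        d 0 ` carrier (F 1) = a_kernel (F 0) M e \<and>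
        (\<forall>n. d (Suc n) ` carrier (F (Suc (Suc n))) = a_kernel (F (Suc n)) (F n) (d n)))"

text \<open>
  Cohomology in degree \<open>n\<close> of the complex \<open>Hom R (F 0) N \<rightarrow> Hom R (F 1) N \<rightarrow> \<dots>\<close> whose maps are
  composition with the differentials.
\<close>

definition hom_cohomology ::
    "('a, 'x) ring_scheme \<Rightarrow> (nat \<Rightarrow> ('a, 'f, 'y) module_scheme) \<Rightarrow> (nat \<Rightarrow> 'f \<Rightarrow> 'f) \<Rightarrow>
     ('a, 'n, 'z) module_scheme \<Rightarrow> nat \<Rightarrow> ('a, ('f \<Rightarrow> 'n) set) module" where
  "hom_cohomology R F d N n =
     (let C = (\<lambda>k. Hom R (F k) N);
          \<delta> = (\<lambda>k h. compose (carrier (F (Suc k))) h (d k));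
          cocycles = a_kernel (C n) (C (Suc n)) (\<delta> n);
          coboundaries = (case n of 0 \<Rightarrow> {\<zero>\<^bsub>C 0\<^esub>} | Suc k \<Rightarrow> \<delta> k ` carrier (C k))
      in quotient_module ((C n)\<lparr>carrier := cocycles\<rparr>) coboundaries)"

text \<open>
  \<open>Ext\<close> is computed from a chosen free resolution of the first argument; up to isomorphism the
  result does not depend on the choice. The bases are subsets of the type \<open>('a + 'm) list\<close>,
  which is infinite and at least as large as \<open>R\<close> and \<open>M\<close>, so such a resolution exists
  for every module \<open>M\<close>.
\<close>

definition Ext ::
    "('a, 'x) ring_scheme \<Rightarrow> ('a, 'm, 'y) module_scheme \<Rightarrow> ('a, 'n, 'z) module_scheme \<Rightarrow> int \<Rightarrow>
     ('a, ((('a + 'm) list \<Rightarrow> 'a) \<Rightarrow> 'n) set) module" where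
  "Ext R M N j =
     (if j < 0 then zero_module
      else let (B, d) = (SOME (B, d). \<exists>e. free_resolution R M B d e)
           in hom_cohomology R (\<lambda>n. free_module R (B n)) d N (nat j))"

definition grade :: "('a, 'x) ring_scheme \<Rightarrow> ('a, 'm, 'y) module_scheme \<Rightarrow> ereal" where
  "grade R M = Inf {ereal (real_of_int i) | i. \<not> is_zero_module (Ext R M (ring_module R) i)}"

end

theory Submission
  imports Defs
begin

text \<open>
  Let \<open>P\<close> be the bottom of a chain of \<open>r + 1\<close> primes in the support of \<open>M\<close>; then \<open>P\<close> has height at
  most \<open>d - r = g\<close>. Supports are closed under specialization, so for the lower bound it suffices that
  \<open>P\<close> lies in the support of \<open>Ext\<^sup>g(M, R)\<close>. If \<open>P\<close> did not, then \<open>Ext\<^sup>i(M, R)\<close> would vanish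
  locally at \<open>P\<close> for all \<open>i \<le> g\<close>. Since \<open>Hom(M, R/P)\<close> does not vanish at \<open>P\<close>, prime avoidance and the
  long exact sequences of \<open>Ext\<close> then produce \<open>g + 1\<close> elements of \<open>P\<close> that are successively regular locally
  at \<open>P\<close>. A prime containing an ideal \<open>I\<close> and an element regular modulo \<open>I\<close> is not minimal over \<open>I\<close>, so
  there is a chain of \<open>g + 2\<close> primes ending at \<open>P\<close>, which contradicts the bound on the height.
\<close>

subsection \<open>Noetherian rings\<close>

text \<open>Once \<open>Supp\<close> is rewritten in terms of torsion, nothing is localized and no
  quotient ring is formed. Every statement at \<open>P\<close> is made in \<open>R\<close>, with a
  multiplier \<open>s\<close> outside \<open>P\<close> in place of a denominator and a
  \<open>P\<close>-saturated ideal in place of an ideal of \<open>R_P\<close>. The obstacle is that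
  the free modules behind \<open>Ext\<close> may have infinite bases, so \<open>Hom\<close> out of
  them need not commute with localization: a claim about each value of a cochain yields one
  multiplier per value, while one for all values is needed. The values on boundaries form an ideal,
  which is finitely generated as \<open>R\<close> is noetherian, and this gives a common multiplier.
  The number of regular elements is a count of degrees. Dividing by one of them costs a degree,
  since vanishing in degree \<open>n\<close> afterwards takes vanishing in degrees \<open>n\<close>
  and \<open>n + 1\<close> before. The degrees below \<open>g\<close> come from the grade, degree
  \<open>g\<close> from the assumption on \<open>P\<close>, which makes \<open>g + 1\<close> in all.
  The upper bound on the dimension is the hypothesis at \<open>i = r\<close>.\<close>

locale noetherian_cring = cring R + noetherian_ring R for R (structure)

text \<open>The preimage in \<open>R\<close> of the extension of \<open>I\<close> to the
  localization at \<open>P\<close>; for the zero ideal it is the kernel of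
  \<open>R -> R_P\<close>.\<close>

definition saturation :: "('a, 'x) ring_scheme \<Rightarrow> 'a set \<Rightarrow> 'a set \<Rightarrow> 'a set" where
  "saturation R P I = {a \<in> carrier R. \<exists>s\<in>carrier R - P. s \<otimes>\<^bsub>R\<^esub> a \<in> I}"

definition adjoin_multiples :: "('a, 'x) ring_scheme \<Rightarrow> 'a set \<Rightarrow> 'a \<Rightarrow> 'a set" where
  "adjoin_multiples R I x = {i \<oplus>\<^bsub>R\<^esub> x \<otimes>\<^bsub>R\<^esub> r | i r. i \<in> I \<and> r \<in> carrier R}"

text \<open>The colon ideal \<open>(I : a)\<close>, that is, the annihilator of the class of
  \<open>a\<close> in \<open>R/I\<close>; those that are prime are the associated primes of
  \<open>R/I\<close>.\<close>

definition annihilator_mod :: "('a, 'x) ring_scheme \<Rightarrow> 'a set \<Rightarrow> 'a \<Rightarrow> 'a set" where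
  "annihilator_mod R I a = {r \<in> carrier R. r \<otimes>\<^bsub>R\<^esub> a \<in> I}"

section \<open>Ideal constructions and prime avoidance\<close>

lemma (in cring) ideal_cringI:
  assumes "I \<subseteq> carrier R" and "\<zero> \<in> I"
    and "\<And>a b. a \<in> I \<Longrightarrow> b \<in> I \<Longrightarrow> a \<oplus> b \<in> I"
    and "\<And>a x. a \<in> I \<Longrightarrow> x \<in> carrier R \<Longrightarrow> x \<otimes> a \<in> I"
  shows "ideal I R"
proof -
  have "\<ominus> a \<in> I" if "a \<in> I" for a
  proof -
    have "(\<ominus> \<one>) \<otimes> a \<in> I" using assms(4)[OF that] by simp
    then show ?thesis using that assms(1) by (metis l_minus l_one one_closed subsetD)
  qed
  then have "subgroup I (add_monoid R)"
    using assms(1-3) by (intro add.subgroupI) (auto simp: a_inv_def)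
  then show ?thesis
    using assms by (intro idealI) (auto simp: m_comm ring_axioms subset_iff)
qed

context cring
begin

lemma annihilator_mod_ideal:
  assumes "ideal I R" "a \<in> carrier R"
  shows "ideal (annihilator_mod R I a) R"
proof -
  interpret I: ideal I R by fact
  show ?thesis
    using assms(2) by (intro ideal_cringI) (auto simp: annihilator_mod_def l_distr m_assoc I.I_l_closed)
qed

lemma adjoin_multiples_ideal:
  assumes "ideal I R" "x \<in> carrier R"
  shows "ideal (adjoin_multiples R I x) R"
proof (intro ideal_cringI)
  interpret I: ideal I R by fact
  show "adjoin_multiples R I x \<subseteq> carrier R"
    using assms(2) by (auto simp: adjoin_multiples_def)
  show "\<zero> \<in> adjoin_multiples R I x"
    unfolding adjoin_multiples_def using assms(2)
    by (auto intro!: exI[of _ "\<zero>"])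
  fix a assume "a \<in> adjoin_multiples R I x"
  then obtain i r where a: "i \<in> I" "r \<in> carrier R" "a = i \<oplus> x \<otimes> r"
    by (auto simp: adjoin_multiples_def)
  {
    fix b assume "b \<in> adjoin_multiples R I x"
    then obtain j t where b: "j \<in> I" "t \<in> carrier R" "b = j \<oplus> x \<otimes> t"
      by (auto simp: adjoin_multiples_def)
    have "a \<oplus> b = (i \<oplus> j) \<oplus> x \<otimes> (r \<oplus> t)"
      using a b assms(2) by (simp add: r_distr a_ac I.Icarr)
    then show "a \<oplus> b \<in> adjoin_multiples R I x"
      unfolding adjoin_multiples_def using a b by blast
  next
    fix y assume y: "y \<in> carrier R"
    have "y \<otimes> a = (y \<otimes> i) \<oplus> x \<otimes> (y \<otimes> r)"
      using a y assms(2) by (simp add: r_distr m_lcomm I.Icarr)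
    then show "y \<otimes> a \<in> adjoin_multiples R I x"
      unfolding adjoin_multiples_def using a y I.I_l_closed by blast
  }
qed

lemma saturation_ideal:
  assumes "ideal I R" "primeideal P R"
  shows "ideal (saturation R P I) R"
proof (intro ideal_cringI)
  interpret I: ideal I R by fact
  interpret P: primeideal P R by fact
  have one: "\<one> \<in> carrier R - P" using P.I_notcarr P.one_imp_carrier by auto
  show "saturation R P I \<subseteq> carrier R" by (auto simp: saturation_def)
  show "\<zero> \<in> saturation R P I" using one by (auto simp: saturation_def intro!: bexI[of _ \<one>])
  fix a assume "a \<in> saturation R P I"
  then obtain s where a: "a \<in> carrier R" "s \<in> carrier R - P" "s \<otimes> a \<in> I"
    by (auto simp: saturation_def)
  {
    fix b assume "b \<in> saturation R P I"
    then obtain t where b: "b \<in> carrier R" "t \<in> carrier R - P" "t \<otimes> b \<in> I"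
      by (auto simp: saturation_def)
    have "(s \<otimes> t) \<otimes> (a \<oplus> b) = t \<otimes> (s \<otimes> a) \<oplus> s \<otimes> (t \<otimes> b)"
      using a b by (simp add: r_distr m_ac)
    then have "(s \<otimes> t) \<otimes> (a \<oplus> b) \<in> I" using a b by (simp add: I.I_l_closed)
    moreover have "s \<otimes> t \<in> carrier R - P" using a b P.I_prime by auto
    ultimately show "a \<oplus> b \<in> saturation R P I" using a b unfolding saturation_def by auto
  next
    fix y assume y: "y \<in> carrier R"
    have "s \<otimes> (y \<otimes> a) = y \<otimes> (s \<otimes> a)" using a y by (simp add: m_lcomm)
    then show "y \<otimes> a \<in> saturation R P I" using a y I.I_l_closed[OF a(3) y] unfolding saturation_def by force
  }
qed

lemma saturation_superset:
  assumes "ideal I R" "primeideal P R"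
  shows "I \<subseteq> saturation R P I"
proof
  interpret I: ideal I R by fact
  interpret P: primeideal P R by fact
  fix a assume "a \<in> I"
  moreover have "\<one> \<in> carrier R - P" using P.I_notcarr P.one_imp_carrier by auto
  ultimately show "a \<in> saturation R P I"
    unfolding saturation_def by (auto intro!: bexI[of _ \<one>] simp: I.Icarr)
qed

text \<open>If \<open>t\<close> takes \<open>s \<otimes> a\<close> into \<open>I\<close>, then
  \<open>t \<otimes> s\<close> takes \<open>a\<close> into \<open>I\<close> and is still outside the
  prime \<open>P\<close>. This supplies the cancellation hypothesis at each stage of the induction
  on regular elements.\<close>

lemma saturation_saturated:
  assumes "primeideal P R" "s \<in> carrier R - P" "a \<in> carrier R" "s \<otimes> a \<in> saturation R P I"
  shows "a \<in> saturation R P I"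
proof -
  interpret P: primeideal P R by fact
  obtain t where t: "t \<in> carrier R - P" "t \<otimes> (s \<otimes> a) \<in> I"
    using assms by (auto simp: saturation_def)
  then have "(t \<otimes> s) \<otimes> a \<in> I" "t \<otimes> s \<in> carrier R - P"
    using assms P.I_prime by (auto simp: m_assoc)
  then show ?thesis using assms(3) by (auto simp: saturation_def)
qed

lemma saturation_subset:
  assumes "primeideal P R" "I \<subseteq> P"
  shows "saturation R P I \<subseteq> P"
proof
  fix a assume "a \<in> saturation R P I"
  then obtain s where "a \<in> carrier R" "s \<in> carrier R - P" "s \<otimes> a \<in> P"
    using assms(2) by (auto simp: saturation_def)
  then show "a \<in> P" using primeideal.I_prime[OF assms(1)] by blast
qed

text \<open>An element outside \<open>Q\<close> is taken from each ideal; the product lies in all of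
  them, and outside \<open>Q\<close> by primality. Used for prime avoidance and for the finiteness
  of the set of maximal annihilators.\<close>

lemma exists_in_ideals_not_in_prime:
  assumes "finite F" "\<And>I. I \<in> F \<Longrightarrow> ideal I R" "primeideal Q R"
    and "\<And>I. I \<in> F \<Longrightarrow> \<not> I \<subseteq> Q" and "ideal J R" "\<not> J \<subseteq> Q"
  shows "\<exists>y\<in>J. (\<forall>I\<in>F. y \<in> I) \<and> y \<notin> Q"
  using assms(1,2,4)
proof (induction F)
  case empty
  then show ?case using assms(6) by auto
next
  case (insert I F)
  interpret Q: primeideal Q R by fact
  interpret J: ideal J R by fact
  interpret I: ideal I R using insert.prems by simp
  from insert obtain y where y: "y \<in> J" "\<And>I. I \<in> F \<Longrightarrow> y \<in> I" "y \<notin> Q" by auto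
  obtain z where z: "z \<in> I" "z \<notin> Q" using insert.prems by blast
  have "z \<otimes> y \<in> K" if "K \<in> F" for K
    using ideal.I_l_closed[of K R y z] insert.prems(1)[of K] that y z by (auto simp: I.Icarr)
  then show ?case
    using y z Q.I_prime[of z y] by (intro bexI[of _ "z \<otimes> y"]) (auto simp: J.Icarr I.Icarr J.I_l_closed I.I_r_closed)
qed

text \<open>By incomparability no earlier prime is contained in the new prime \<open>Q\<close>, so
  some element of \<open>J\<close> lies in all earlier primes but not in \<open>Q\<close>; it
  corrects an element that avoids only the earlier ones. The maximal annihilators, to which this is
  applied, are incomparable by construction.\<close>

lemma prime_avoidance_antichain:
  assumes "finite F" "\<And>Q. Q \<in> F \<Longrightarrow> primeideal Q R"
    and "\<And>Q Q'. Q \<in> F \<Longrightarrow> Q' \<in> F \<Longrightarrow> Q \<subseteq> Q' \<Longrightarrow> Q = Q'"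
    and "ideal J R" "\<And>Q. Q \<in> F \<Longrightarrow> \<not> J \<subseteq> Q"
  shows "\<exists>x\<in>J. \<forall>Q\<in>F. x \<notin> Q"
  using assms(1,2,3,5)
proof (induction F)
  case empty
  then show ?case
    using additive_subgroup.zero_closed[OF ideal.axioms(1)[OF assms(4)]] by auto
next
  case (insert Q F)
  interpret J: ideal J R by fact
  interpret Q: primeideal Q R using insert.prems by simp
  obtain x where x: "x \<in> J" "\<forall>Q\<in>F. x \<notin> Q" using insert by (metis insertCI)
  show ?case
  proof (cases "x \<in> Q")
    case True
    have "\<exists>y\<in>J. (\<forall>I\<in>F. y \<in> I) \<and> y \<notin> Q"
    proof (rule exists_in_ideals_not_in_prime)
      fix I assume "I \<in> F"
      then show "ideal I R" using insert.prems(1)[of I] primeideal.axioms(1) by blast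
      show "\<not> I \<subseteq> Q" using \<open>I \<in> F\<close> insert.hyps insert.prems(2)[of I Q] by auto
    qed (use insert assms Q.primeideal in auto)
    then obtain y where y: "y \<in> J" "\<forall>I\<in>F. y \<in> I" "y \<notin> Q" by auto
    have cancel: "b \<in> I" if "ideal I R" "a \<in> I" "b \<in> carrier R" "a \<oplus> b \<in> I" for I a b
    proof -
      interpret I: ideal I R by fact
      have "\<ominus> a \<oplus> (a \<oplus> b) \<in> I" using that by simp
      then show ?thesis using that by (simp add: r_neg1 I.Icarr)
    qed
    \<comment> \<open>Modulo \<open>Q\<close> the sum is \<open>y\<close>, modulo an earlier prime
      it is \<open>x\<close>; neither vanishes.\<close>
    have "x \<oplus> y \<notin> Q" using cancel[OF Q.is_ideal] True y J.Icarr by blast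
    moreover have "x \<oplus> y \<notin> I" if "I \<in> F" for I
      using cancel[of I y x] insert.prems(1)[of I] primeideal.axioms(1)[of I R] that x y J.Icarr
      by (auto simp: a_comm)
    ultimately show ?thesis using x y by (intro bexI[of _ "x \<oplus> y"]) auto
  next
    case False
    then show ?thesis using x by auto
  qed
qed

end

section \<open>Consequences of the ascending chain condition\<close>

context noetherian_cring
begin

text \<open>A nonempty chain of ideals contains its union, so Zorn's lemma applies. The family is
  indexed by \<open>f\<close> because later it is the index that matters: an element with maximal
  annihilator, or a finite set generating a largest ideal.\<close>

lemma exists_maximal_ideal_in:
  assumes "a \<in> C" "\<And>b. b \<in> C \<Longrightarrow> ideal (f b) R"
  obtains b where "b \<in> C" "\<And>c. c \<in> C \<Longrightarrow> f b \<subseteq> f c \<Longrightarrow> f c = f b"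
proof -
  have "\<exists>I\<in>f ` C. \<forall>J\<in>f ` C. I \<subseteq> J \<longrightarrow> J = I"
  proof (rule subset_Zorn_nonempty)
    show "f ` C \<noteq> {}" using assms(1) by blast
    fix D assume D: "D \<noteq> {}" "subset.chain (f ` C) D"
    have "f ` C \<subseteq> {I. ideal I R}" using assms(2) by blast
    then have "subset.chain {I. ideal I R} D" using D(2) unfolding pred_on.chain_def by (meson order_trans)
    then have "\<Union>D \<in> D" using ideal_chain_is_trivial D(1) by simp
    then show "\<Union>D \<in> f ` C" using D(2) unfolding pred_on.chain_def by (meson subsetD)
  qed
  then obtain I where I: "I \<in> f ` C" "\<forall>J\<in>f ` C. I \<subseteq> J \<longrightarrow> J = I" by (elim bexE)
  from I(1) obtain b where "b \<in> C" "I = f b" by (elim imageE)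
  then show thesis using that[of b] I(2) by simp
qed

text \<open>An ideal maximal among those that contain \<open>I\<close> and miss \<open>T\<close> is
  prime; the chain condition provides the maximum.\<close>

lemma exists_prime_disjoint:
  assumes "ideal I R" "T \<subseteq> carrier R" "T \<noteq> {}" "\<And>s t. s \<in> T \<Longrightarrow> t \<in> T \<Longrightarrow> s \<otimes> t \<in> T" "I \<inter> T = {}"
  shows "\<exists>Q. primeideal Q R \<and> I \<subseteq> Q \<and> Q \<inter> T = {}"
proof -
  obtain Q where "Q \<in> {Q. ideal Q R \<and> I \<subseteq> Q \<and> Q \<inter> T = {}}"
    and maxQ: "\<And>J. J \<in> {Q. ideal Q R \<and> I \<subseteq> Q \<and> Q \<inter> T = {}} \<Longrightarrow> Q \<subseteq> J \<Longrightarrow> J = Q"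
    by (rule exists_maximal_ideal_in[of I "{Q. ideal Q R \<and> I \<subseteq> Q \<and> Q \<inter> T = {}}" "\<lambda>Q. Q"])
      (use assms(1,5) in auto)
  then have Q: "ideal Q R" "I \<subseteq> Q" "Q \<inter> T = {}" by simp_all
  have max: "J = Q" if "ideal J R" "J \<inter> T = {}" "Q \<subseteq> J" for J
    using maxQ[of J] that Q(2) by (simp add: order_trans)
  interpret Q: ideal Q R by fact
  \<comment> \<open>By maximality, adding to \<open>Q\<close> any \<open>a\<close> outside it
    creates an element of \<open>T\<close>.\<close>
  have meets: "\<exists>i\<in>Q. \<exists>r\<in>carrier R. i \<oplus> a \<otimes> r \<in> T" if a: "a \<in> carrier R" "a \<notin> Q" for a
  proof -
    have id: "ideal (adjoin_multiples R Q a) R" using adjoin_multiples_ideal Q a by blast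
    have "Q \<subseteq> adjoin_multiples R Q a"
      using a by (force simp: adjoin_multiples_def Q.Icarr intro: exI[of _ \<zero>])
    moreover have "a \<in> adjoin_multiples R Q a"
      using a unfolding adjoin_multiples_def by (intro CollectI exI[of _ \<zero>] exI[of _ \<one>]) auto
    ultimately have "adjoin_multiples R Q a \<inter> T \<noteq> {}" using max[OF id] a by blast
    then show ?thesis by (auto simp: adjoin_multiples_def)
  qed
  have "primeideal Q R"
  proof (rule primeidealI[OF Q(1)])
    show "cring R" by (rule is_cring)
    show "carrier R \<noteq> Q" using assms Q by auto
    fix a b assume ab: "a \<in> carrier R" "b \<in> carrier R" "a \<otimes> b \<in> Q"
    show "a \<in> Q \<or> b \<in> Q"
    proof (rule ccontr)
      assume "\<not> ?thesis"
      then obtain i r j t where *: "i \<in> Q" "r \<in> carrier R" "i \<oplus> a \<otimes> r \<in> T"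
        "j \<in> Q" "t \<in> carrier R" "j \<oplus> b \<otimes> t \<in> T" using meets ab by metis
      \<comment> \<open>Every term except the last has a factor in \<open>Q\<close>, and the last
        one lies in \<open>Q\<close> because \<open>a \<otimes> b\<close> does; yet the product
        belongs to \<open>T\<close>.\<close>
      have "(i \<oplus> a \<otimes> r) \<otimes> (j \<oplus> b \<otimes> t) = i \<otimes> (j \<oplus> b \<otimes> t) \<oplus> (a \<otimes> r \<otimes> j \<oplus> r \<otimes> t \<otimes> (a \<otimes> b))"
        using * ab by (simp add: l_distr r_distr m_ac a_ac Q.Icarr)
      also have "\<dots> \<in> Q" using * ab by (simp add: Q.I_l_closed Q.I_r_closed Q.Icarr)
      finally show False using assms(4)[OF *(3,6)] Q by auto
    qed
  qed
  then show ?thesis using Q by auto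
qed

text \<open>A finite \<open>T\<close> inside \<open>X\<close> is taken with \<open>Idl T\<close>
  maximal: a further element of \<open>X\<close> cannot enlarge it. That \<open>T\<close> lies in
  \<open>X\<close> matters when \<open>X\<close> is the set of elements with maximal annihilator,
  which is not an ideal.\<close>

lemma finite_subset_generates:
  assumes "X \<subseteq> carrier R"
  shows "\<exists>T. finite T \<and> T \<subseteq> X \<and> X \<subseteq> Idl T"
proof -
  obtain T where "T \<in> {T. finite T \<and> T \<subseteq> X}"
    and max: "\<And>S. S \<in> {T. finite T \<and> T \<subseteq> X} \<Longrightarrow> Idl T \<subseteq> Idl S \<Longrightarrow> Idl S = Idl T"
    by (rule exists_maximal_ideal_in[of "{}" "{T. finite T \<and> T \<subseteq> X}" "\<lambda>T. Idl T"])
      (use assms genideal_ideal in auto)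
  then have T: "finite T" "T \<subseteq> X" by simp_all
  have "x \<in> Idl T" if "x \<in> X" for x
  proof -
    have sub: "insert x T \<subseteq> Idl (insert x T)" using that T assms by (intro genideal_self) auto
    then have "Idl T \<subseteq> Idl (insert x T)"
      using that T assms by (intro genideal_minimal genideal_ideal) auto
    then show ?thesis using max[of "insert x T"] sub that T by auto
  qed
  then show ?thesis using T by blast
qed

text \<open>The multipliers of finitely many generators of \<open>J\<close> are multiplied together.
  Here finite generation of ideals makes up for possibly infinite bases in the resolution.\<close>

lemma uniform_multiplier:
  assumes "primeideal P R" "ideal J R" "ideal K R"
    and "\<And>a. a \<in> J \<Longrightarrow> \<exists>s\<in>carrier R - P. s \<otimes> a \<in> K"
  shows "\<exists>s\<in>carrier R - P. \<forall>a\<in>J. s \<otimes> a \<in> K"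
proof -
  interpret P: primeideal P R by fact
  interpret J: ideal J R by fact
  interpret K: ideal K R by fact
  have fin: "\<exists>s\<in>carrier R - P. \<forall>a\<in>T. s \<otimes> a \<in> K" if "finite T" "T \<subseteq> J" for T
    using that
  proof (induction T)
    case empty
    have "\<one> \<in> carrier R - P" using P.I_notcarr P.one_imp_carrier by auto
    then show ?case by auto
  next
    case (insert a T)
    then obtain s where s: "s \<in> carrier R - P" "\<forall>a\<in>T. s \<otimes> a \<in> K" by auto
    obtain t where t: "t \<in> carrier R - P" "t \<otimes> a \<in> K" using assms(4)[of a] insert.prems by auto
    have "(s \<otimes> t) \<otimes> b \<in> K" if "b \<in> insert a T" for b
    proof -
      have b: "b \<in> carrier R" using that insert.prems by (auto simp: J.Icarr)
      have "(s \<otimes> t) \<otimes> b = s \<otimes> (t \<otimes> b)" "(s \<otimes> t) \<otimes> b = t \<otimes> (s \<otimes> b)"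
        using s t b by (simp_all add: m_ac)
      then show ?thesis using that s t by (metis DiffD1 K.I_l_closed insertE)
    qed
    moreover have "s \<otimes> t \<in> carrier R - P" using s t P.I_prime by auto
    ultimately show ?case by blast
  qed
  obtain T where T: "finite T" "T \<subseteq> J" "J \<subseteq> Idl T" using finite_subset_generates[of J] J.a_subset by auto
  obtain s where s: "s \<in> carrier R - P" "\<forall>a\<in>T. s \<otimes> a \<in> K" using fin[OF T(1,2)] by auto
  \<comment> \<open>The elements that \<open>s\<close> takes into \<open>K\<close> form an ideal, so
    the generators decide.\<close>
  have "ideal {a \<in> carrier R. s \<otimes> a \<in> K} R"
    using s by (intro ideal_cringI) (auto simp: r_distr m_lcomm[of s] K.I_l_closed)
  then have "Idl T \<subseteq> {a \<in> carrier R. s \<otimes> a \<in> K}"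
    using s T by (intro genideal_minimal) (auto simp: J.Icarr)
  then show ?thesis using s T by blast
qed

text \<open>The zero divisors modulo \<open>I\<close> are covered by the maximal annihilators of
  elements outside \<open>I\<close>, which are finitely many primes. By avoidance \<open>J\<close>
  lies in one of them, and that one is the annihilator of a single element.\<close>

lemma exists_common_annihilated_element:
  assumes "ideal I R" "ideal J R"
    and zero_div: "\<And>x. x \<in> J \<Longrightarrow> \<exists>a\<in>carrier R - I. x \<otimes> a \<in> I"
  shows "\<exists>a\<in>carrier R - I. \<forall>x\<in>J. x \<otimes> a \<in> I"
proof -
  interpret I: ideal I R by fact
  interpret J: ideal J R by fact
  define An where "An = annihilator_mod R I"
  have An_ideal: "ideal (An a) R" if "a \<in> carrier R" for a
    using annihilator_mod_ideal assms(1) that by (simp add: An_def)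
  define X where "X = {a \<in> carrier R - I. \<forall>b\<in>carrier R - I. An a \<subseteq> An b \<longrightarrow> An b = An a}"
  have prime: "primeideal (An a) R" if a: "a \<in> X" for a
  proof (rule primeidealI)
    have aR: "a \<in> carrier R" "a \<notin> I" using a by (auto simp: X_def)
    show "ideal (An a) R" by (rule An_ideal[OF aR(1)])
    have "\<one> \<notin> An a" using aR by (simp add: An_def annihilator_mod_def)
    then show "carrier R \<noteq> An a" by auto
    fix r t assume rt: "r \<in> carrier R" "t \<in> carrier R" "r \<otimes> t \<in> An a"
    show "r \<in> An a \<or> t \<in> An a"
    proof (cases "t \<in> An a")
      case False
      \<comment> \<open>\<open>t \<otimes> a\<close> is outside \<open>I\<close> and its annihilator
        is at least as large as that of \<open>a\<close>, hence the same by maximality.\<close>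
      then have "t \<otimes> a \<in> carrier R - I" using rt aR by (auto simp: An_def annihilator_mod_def)
      moreover have "An a \<subseteq> An (t \<otimes> a)"
        using rt aR by (auto simp: An_def annihilator_mod_def m_lcomm[of _ t] I.I_l_closed)
      ultimately have "An (t \<otimes> a) = An a" using a by (auto simp: X_def)
      moreover have "r \<in> An (t \<otimes> a)"
        using rt aR by (auto simp: An_def annihilator_mod_def m_assoc)
      ultimately show ?thesis by simp
    qed simp
  qed (rule is_cring)
  obtain T where T: "finite T" "T \<subseteq> X" "X \<subseteq> Idl T"
    using finite_subset_generates[of X] by (auto simp: X_def)
  \<comment> \<open>Every maximal annihilator occurs at an element of the finite set
    \<open>T\<close>. Otherwise some \<open>y\<close> outside \<open>An a\<close> would annihilate
    \<open>T\<close> modulo \<open>I\<close>, hence all of \<open>Idl T\<close>, which contains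
    \<open>a\<close>.\<close>
  have "An ` X \<subseteq> An ` T"
  proof
    fix A assume "A \<in> An ` X"
    then obtain a where a: "a \<in> X" "A = An a" by auto
    have "\<exists>t\<in>T. An t \<subseteq> An a"
    proof (rule ccontr)
      assume no: "\<not> ?thesis"
      have "\<exists>y\<in>carrier R. (\<forall>K\<in>An ` T. y \<in> K) \<and> y \<notin> An a"
      proof (rule exists_in_ideals_not_in_prime[OF _ _ prime[OF a(1)]])
        show "\<not> carrier R \<subseteq> An a"
          using primeideal.I_notcarr[OF prime[OF a(1)]] ideal.Icarr[OF An_ideal] a(1) by (auto simp: X_def)
      qed (use T no An_ideal oneideal in \<open>auto simp: X_def\<close>)
      then obtain y where y: "y \<in> carrier R" "\<forall>t\<in>T. y \<in> An t" "y \<notin> An a" by auto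
      have "ideal {z \<in> carrier R. y \<otimes> z \<in> I} R"
        using y by (intro ideal_cringI) (auto simp: r_distr m_lcomm[of y] I.I_l_closed)
      then have "Idl T \<subseteq> {z \<in> carrier R. y \<otimes> z \<in> I}"
        using y T by (intro genideal_minimal) (auto simp: X_def An_def annihilator_mod_def)
      then show False using a y T by (auto simp: X_def An_def annihilator_mod_def)
    qed
    then obtain t where "t \<in> T" "An t \<subseteq> An a" by auto
    then have "An t = An a" using T a by (auto simp: X_def)
    then show "A \<in> An ` T" using \<open>t \<in> T\<close> a by auto
  qed
  then have fin: "finite (An ` X)" using T finite_surj by blast
  have "\<exists>Q\<in>An ` X. J \<subseteq> Q"
  proof (rule ccontr)
    assume "\<not> ?thesis"
    then have "\<And>Q. Q \<in> An ` X \<Longrightarrow> \<not> J \<subseteq> Q" by blast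
    moreover have "\<And>Q Q'. Q \<in> An ` X \<Longrightarrow> Q' \<in> An ` X \<Longrightarrow> Q \<subseteq> Q' \<Longrightarrow> Q = Q'"
      by (auto simp: X_def)
    moreover have "\<And>Q. Q \<in> An ` X \<Longrightarrow> primeideal Q R" using prime by blast
    ultimately have "\<exists>x\<in>J. \<forall>Q\<in>An ` X. x \<notin> Q"
      using prime_avoidance_antichain[OF fin _ _ assms(2)] by presburger
    then obtain x where x: "x \<in> J" "\<forall>a\<in>X. x \<notin> An a" by auto
    obtain a where a: "a \<in> carrier R - I" "x \<otimes> a \<in> I" using zero_div x by blast
    \<comment> \<open>The annihilator of \<open>a\<close> may fail to be maximal; it is enlarged to
      one that is, and \<open>x\<close> stays in it.\<close>
    obtain b where "b \<in> {b \<in> carrier R - I. An a \<subseteq> An b}"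
      and max: "\<And>c. c \<in> {b \<in> carrier R - I. An a \<subseteq> An b} \<Longrightarrow> An b \<subseteq> An c \<Longrightarrow> An c = An b"
      by (rule exists_maximal_ideal_in[of a "{b \<in> carrier R - I. An a \<subseteq> An b}" An])
        (use a An_ideal in auto)
    then have b: "b \<in> carrier R - I" "An a \<subseteq> An b" by simp_all
    have "An c = An b" if "c \<in> carrier R - I" "An b \<subseteq> An c" for c
      using max[of c] that b(2) by (simp add: order_trans)
    then have "b \<in> X" using b(1) by (simp add: X_def)
    moreover have "x \<in> An a" using a x by (auto simp: An_def annihilator_mod_def J.Icarr)
    ultimately show False using x b by auto
  qed
  then show ?thesis by (auto simp: X_def An_def annihilator_mod_def)
qed

text \<open>The multiplicative set generated by \<open>x\<close> and the complement of
  \<open>Q\<close> misses \<open>I\<close>: regularity strips off the powers of \<open>x\<close>,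
  and what remains is outside \<open>Q\<close>. A prime over \<open>I\<close> that misses this set
  lies in \<open>Q\<close> and does not contain \<open>x\<close>.\<close>

lemma exists_smaller_prime:
  assumes "ideal I R" "primeideal Q R" "I \<subseteq> Q" "x \<in> Q"
    and regular: "\<And>a. a \<in> carrier R \<Longrightarrow> x \<otimes> a \<in> I \<Longrightarrow> a \<in> I"
  shows "\<exists>Q'. primeideal Q' R \<and> I \<subseteq> Q' \<and> Q' \<subset> Q"
proof -
  interpret Q: primeideal Q R by fact
  have x: "x \<in> carrier R" using assms(4) by (rule Q.Icarr)
  have one: "\<one> \<in> carrier R - Q" using Q.I_notcarr Q.one_imp_carrier by auto
  define T where "T = {x [^] k \<otimes> t | (k :: nat) t. t \<in> carrier R - Q} "
  have T: "x [^] (k::nat) \<otimes> t \<in> T" if "t \<in> carrier R - Q" for k t using that unfolding T_def by blast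
  have "\<exists>Q'. primeideal Q' R \<and> I \<subseteq> Q' \<and> Q' \<inter> T = {}"
  proof (rule exists_prime_disjoint[OF assms(1)])
    show "T \<subseteq> carrier R" using x by (auto simp: T_def)
    show "T \<noteq> {}" using T one by blast
    fix s t assume "s \<in> T" "t \<in> T"
    then obtain k l :: nat and u v where *: "s = x [^] k \<otimes> u" "t = x [^] l \<otimes> v"
      "u \<in> carrier R - Q" "v \<in> carrier R - Q" by (auto simp: T_def)
    then have "s \<otimes> t = x [^] (k + l) \<otimes> (u \<otimes> v)"
      using x by (simp add: nat_pow_mult[symmetric] m_ac)
    moreover have "u \<otimes> v \<in> carrier R - Q" using * Q.I_prime by auto
    ultimately show "s \<otimes> t \<in> T" using T by simp
  next
    have "t \<in> I" if "t \<in> carrier R" "x [^] k \<otimes> t \<in> I" for t and k :: nat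
      using that
    proof (induction k arbitrary: t)
      case (Suc k)
      have "x [^] k \<otimes> (x \<otimes> t) \<in> I" using Suc.prems x by (simp add: m_ac)
      then show ?case using Suc x regular by blast
    qed simp
    then show "I \<inter> T = {}" using assms(3) by (auto simp: T_def)
  qed
  then obtain Q' where Q': "primeideal Q' R" "I \<subseteq> Q'" "Q' \<inter> T = {}" by auto
  \<comment> \<open>Exponent 0 puts the complement of \<open>Q\<close> into \<open>T\<close>,
    exponent 1 puts \<open>x\<close> there.\<close>
  have "t \<in> T" if "t \<in> carrier R - Q" for t using T[OF that, of 0] that by simp
  then have "Q' \<subseteq> Q" using Q' ideal.Icarr[OF primeideal.axioms(1)[OF Q'(1)]] by blast
  moreover have "x \<in> T" using T[OF one, of 1] x by simp
  ultimately show ?thesis using Q' assms(4) by blast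
qed

end

subsection \<open>Modules\<close>

lemma linear_mapsI:
  assumes "h \<in> carrier M \<rightarrow>\<^sub>E carrier N"
    and "\<And>x y. x \<in> carrier M \<Longrightarrow> y \<in> carrier M \<Longrightarrow> h (x \<oplus>\<^bsub>M\<^esub> y) = h x \<oplus>\<^bsub>N\<^esub> h y"
    and "\<And>a x. a \<in> carrier R \<Longrightarrow> x \<in> carrier M \<Longrightarrow> h (a \<odot>\<^bsub>M\<^esub> x) = a \<odot>\<^bsub>N\<^esub> h x"
  shows "h \<in> linear_maps R M N"
  using assms by (simp add: linear_maps_def)

lemma linear_maps_closed [simp]: "h \<in> linear_maps R M N \<Longrightarrow> x \<in> carrier M \<Longrightarrow> h x \<in> carrier N"
  and linear_maps_add: "h \<in> linear_maps R M N \<Longrightarrow> x \<in> carrier M \<Longrightarrow> y \<in> carrier M \<Longrightarrow>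
    h (x \<oplus>\<^bsub>M\<^esub> y) = h x \<oplus>\<^bsub>N\<^esub> h y"
  and linear_maps_smult: "h \<in> linear_maps R M N \<Longrightarrow> a \<in> carrier R \<Longrightarrow> x \<in> carrier M \<Longrightarrow>
    h (a \<odot>\<^bsub>M\<^esub> x) = a \<odot>\<^bsub>N\<^esub> h x"
  and linear_maps_extensional: "h \<in> linear_maps R M N \<Longrightarrow> h \<in> extensional (carrier M)"
  by (auto simp: linear_maps_def PiE_iff)

lemma linear_maps_zero:
  assumes "module R M" "module R N" "h \<in> linear_maps R M N"
  shows "h \<zero>\<^bsub>M\<^esub> = \<zero>\<^bsub>N\<^esub>"
proof -
  interpret M: module R M by fact
  interpret N: module R N by fact
  have "h (\<zero>\<^bsub>R\<^esub> \<odot>\<^bsub>M\<^esub> \<zero>\<^bsub>M\<^esub>) = \<zero>\<^bsub>R\<^esub> \<odot>\<^bsub>N\<^esub> h \<zero>\<^bsub>M\<^esub>"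
    using assms(3) by (intro linear_maps_smult) auto
  then show ?thesis using assms(3) by simp
qed

lemma linear_maps_minus:
  assumes "module R M" "module R N" "h \<in> linear_maps R M N" "x \<in> carrier M"
  shows "h (\<ominus>\<^bsub>M\<^esub> x) = \<ominus>\<^bsub>N\<^esub> h x"
proof -
  interpret M: module R M by fact
  interpret N: module R N by fact
  have "\<ominus>\<^bsub>M\<^esub> x = (\<ominus>\<^bsub>R\<^esub> \<one>\<^bsub>R\<^esub>) \<odot>\<^bsub>M\<^esub> x" using assms(4) by (simp add: M.smult_l_minus)
  then have "h (\<ominus>\<^bsub>M\<^esub> x) = (\<ominus>\<^bsub>R\<^esub> \<one>\<^bsub>R\<^esub>) \<odot>\<^bsub>N\<^esub> h x"
    using assms(3,4) linear_maps_smult[of h R M N "\<ominus>\<^bsub>R\<^esub> \<one>\<^bsub>R\<^esub>" x] by simp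
  then show ?thesis using assms(3,4) by (simp add: N.smult_l_minus)
qed

lemma linear_maps_compose:
  assumes "h \<in> linear_maps R M N" "k \<in> linear_maps R L M" "module R L"
  shows "compose (carrier L) h k \<in> linear_maps R L N"
proof -
  interpret L: module R L by fact
  show ?thesis
    using assms(1,2)
    by (intro linear_mapsI) (auto simp: compose_def linear_maps_add[of h] linear_maps_add[of k] linear_maps_smult[of h] linear_maps_smult[of k])
qed

lemma a_kernel_iff: "x \<in> a_kernel M N h \<longleftrightarrow> x \<in> carrier M \<and> h x = \<zero>\<^bsub>N\<^esub>"
  by (simp add: a_kernel_def')

lemma a_kernel_submodule:
  assumes "module R M" "module R N" "h \<in> linear_maps R M N"
  shows "submodule (a_kernel M N h) R M"
proof -
  interpret M: module R M by fact
  interpret N: module R N by fact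
  show ?thesis
    using assms(3) linear_maps_zero[OF assms] linear_maps_minus[OF assms]
    by (intro M.submoduleI) (auto simp: a_kernel_iff linear_maps_add linear_maps_smult)
qed

lemma ring_module_simps [simp]:
  "carrier (ring_module R) = carrier R" "\<zero>\<^bsub>ring_module R\<^esub> = \<zero>\<^bsub>R\<^esub>"
  "x \<oplus>\<^bsub>ring_module R\<^esub> y = x \<oplus>\<^bsub>R\<^esub> y" "a \<odot>\<^bsub>ring_module R\<^esub> x = a \<otimes>\<^bsub>R\<^esub> x"
  by (simp_all add: ring_module_def)

lemma (in cring) ring_module_module: "module R (ring_module R)"
proof (intro moduleI abelian_groupI)
  show "\<exists>y\<in>carrier (ring_module R). y \<oplus>\<^bsub>ring_module R\<^esub> x = \<zero>\<^bsub>ring_module R\<^esub>"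
    if "x \<in> carrier (ring_module R)" for x
    using that by (intro bexI[of _ "\<ominus> x"]) (auto simp: l_neg)
qed (auto simp: l_distr r_distr m_assoc a_ac is_cring)

lemma Hom_simps [simp]:
  "carrier (Hom R M N) = linear_maps R M N" "\<zero>\<^bsub>Hom R M N\<^esub> = (\<lambda>x\<in>carrier M. \<zero>\<^bsub>N\<^esub>)"
  "f \<oplus>\<^bsub>Hom R M N\<^esub> g = (\<lambda>x\<in>carrier M. f x \<oplus>\<^bsub>N\<^esub> g x)"
  "a \<odot>\<^bsub>Hom R M N\<^esub> f = (\<lambda>x\<in>carrier M. a \<odot>\<^bsub>N\<^esub> f x)"
  by (simp_all add: Hom_def)

lemma Hom_module:
  assumes "module R M" "module R N"
  shows "module R (Hom R M N)"
proof -
  interpret M: module R M by fact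
  interpret N: module R N by fact
  have add: "(\<lambda>x\<in>carrier M. f x \<oplus>\<^bsub>N\<^esub> g x) \<in> linear_maps R M N"
    if "f \<in> linear_maps R M N" "g \<in> linear_maps R M N" for f g
    using that
    by (intro linear_mapsI) (auto simp: linear_maps_add linear_maps_smult N.smult_r_distr N.a_ac)
  have smult: "(\<lambda>x\<in>carrier M. a \<odot>\<^bsub>N\<^esub> f x) \<in> linear_maps R M N"
    if "f \<in> linear_maps R M N" "a \<in> carrier R" for f a
    using that
    by (intro linear_mapsI)
      (auto simp: linear_maps_add linear_maps_smult N.smult_r_distr N.smult_assoc1[symmetric] M.m_comm)
  have eqI: "f = g" if "f \<in> extensional (carrier M)" "g \<in> extensional (carrier M)"
    "\<And>x. x \<in> carrier M \<Longrightarrow> f x = g x" for f g :: "'c \<Rightarrow> 'e"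
    using that by (rule extensionalityI)
  show ?thesis
  proof (intro moduleI abelian_groupI)
    fix f assume f: "f \<in> carrier (Hom R M N)"
    have "(\<lambda>x\<in>carrier M. (\<ominus>\<^bsub>R\<^esub> \<one>\<^bsub>R\<^esub>) \<odot>\<^bsub>N\<^esub> f x) \<in> linear_maps R M N"
      using f by (intro smult) auto
    then show "\<exists>g\<in>carrier (Hom R M N). g \<oplus>\<^bsub>Hom R M N\<^esub> f = \<zero>\<^bsub>Hom R M N\<^esub>"
      using f by (auto intro!: bexI eqI simp: N.smult_l_minus N.l_neg)
  next
    show "\<zero>\<^bsub>Hom R M N\<^esub> \<in> carrier (Hom R M N)" by (auto intro!: linear_mapsI)
  qed (auto intro!: eqI add smult simp: N.smult_l_distr N.smult_r_distr N.smult_assoc1 N.a_ac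
      linear_maps_extensional M.is_cring)
qed

lemma quotient_module_simps [simp]:
  "carrier (quotient_module M H) = a_rcosets\<^bsub>M\<^esub> H" "\<zero>\<^bsub>quotient_module M H\<^esub> = H"
  "X \<oplus>\<^bsub>quotient_module M H\<^esub> Y = X <+>\<^bsub>M\<^esub> Y"
  by (simp_all add: quotient_module_def)

lemma submodule_abelian_subgroup:
  assumes "module R M" "submodule H R M"
  shows "abelian_subgroup H M"
  using assms by (intro abelian_subgroupI3 additive_subgroup.intro)
    (auto simp: module_def submodule_def)

text \<open>The scalar multiple of a coset is defined as a union over all its representatives.
  Scaling sends the elements of one coset of \<open>H\<close> into one coset, so all sets in the
  union coincide.\<close>

lemma quotient_module_smult_coset:
  assumes "module R M" "submodule H R M" "a \<in> carrier R" "x \<in> carrier M"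
  shows "a \<odot>\<^bsub>quotient_module M H\<^esub> (H +>\<^bsub>M\<^esub> x) = H +>\<^bsub>M\<^esub> (a \<odot>\<^bsub>M\<^esub> x)"
proof -
  interpret M: module R M by fact
  interpret H: abelian_subgroup H M using assms(1,2) by (rule submodule_abelian_subgroup)
  have "H +>\<^bsub>M\<^esub> (a \<odot>\<^bsub>M\<^esub> y) = H +>\<^bsub>M\<^esub> (a \<odot>\<^bsub>M\<^esub> x)" if y: "y \<in> H +>\<^bsub>M\<^esub> x" for y
  proof -
    obtain h where h: "h \<in> H" "y = h \<oplus>\<^bsub>M\<^esub> x" using y by (auto simp: a_r_coset_def')
    have "a \<odot>\<^bsub>M\<^esub> y = a \<odot>\<^bsub>M\<^esub> h \<oplus>\<^bsub>M\<^esub> a \<odot>\<^bsub>M\<^esub> x" using h assms(3,4) by (simp add: M.smult_r_distr H.a_Hcarr)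
    moreover have "a \<odot>\<^bsub>M\<^esub> h \<in> H" using M.submoduleE(4)[OF assms(2)] h assms(3) by blast
    ultimately have "a \<odot>\<^bsub>M\<^esub> y \<in> H +>\<^bsub>M\<^esub> (a \<odot>\<^bsub>M\<^esub> x)" by (auto simp: a_r_coset_def')
    then show ?thesis using assms(3,4) H.a_repr_independence' by (metis M.smult_closed)
  qed
  moreover have "x \<in> H +>\<^bsub>M\<^esub> x" using assms(4) by (rule H.a_rcos_self)
  ultimately have "(\<Union>y\<in>H +>\<^bsub>M\<^esub> x. H +>\<^bsub>M\<^esub> (a \<odot>\<^bsub>M\<^esub> y)) = H +>\<^bsub>M\<^esub> (a \<odot>\<^bsub>M\<^esub> x)"
    by blast
  then show ?thesis by (simp add: quotient_module_def)
qed

lemma quotient_module_module: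
  assumes "module R M" "submodule H R M"
  shows "module R (quotient_module M H)"
proof -
  interpret M: module R M by fact
  interpret H: abelian_subgroup H M using assms by (rule submodule_abelian_subgroup)
  have coset: "\<exists>x\<in>carrier M. X = H +>\<^bsub>M\<^esub> x" if "X \<in> a_rcosets\<^bsub>M\<^esub> H" for X
    using that by (auto simp: A_RCOSETS_def')
  have cosetI: "H +>\<^bsub>M\<^esub> x \<in> a_rcosets\<^bsub>M\<^esub> H" if "x \<in> carrier M" for x
    using that by (auto simp: A_RCOSETS_def')
  note smult = quotient_module_smult_coset[OF assms]
  show ?thesis
  proof (rule moduleI)
    have zero: "H = H +>\<^bsub>M\<^esub> \<zero>\<^bsub>M\<^esub>" using H.a_subset by simp
    show "abelian_group (quotient_module M H)"
    proof (rule abelian_groupI)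
      fix X assume "X \<in> carrier (quotient_module M H)"
      then obtain x where x: "x \<in> carrier M" "X = H +>\<^bsub>M\<^esub> x" using coset by auto
      then have "(H +>\<^bsub>M\<^esub> (\<ominus>\<^bsub>M\<^esub> x)) <+>\<^bsub>M\<^esub> X = H"
        using zero by (simp add: H.a_rcos_sum M.l_neg)
      then show "\<exists>Y\<in>carrier (quotient_module M H).
          Y \<oplus>\<^bsub>quotient_module M H\<^esub> X = \<zero>\<^bsub>quotient_module M H\<^esub>"
        using x cosetI[of "\<ominus>\<^bsub>M\<^esub> x"] by (intro bexI[of _ "H +>\<^bsub>M\<^esub> (\<ominus>\<^bsub>M\<^esub> x)"]) auto
    qed (auto dest!: coset simp: cosetI H.a_rcos_sum M.a_ac H.rcosets_add_eq intro: H.a_subgroup_in_rcosets)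
  qed (auto dest!: coset simp: smult cosetI H.a_rcos_sum M.smult_l_distr M.smult_r_distr
      M.smult_assoc1 M.is_cring)
qed

section \<open>Localization and support\<close>

lemma fraction_rel_iff:
  "((m, s), (n, t)) \<in> fraction_rel S M \<longleftrightarrow>
    m \<in> carrier M \<and> s \<in> S \<and> n \<in> carrier M \<and> t \<in> S \<and> (\<exists>u\<in>S. u \<odot>\<^bsub>M\<^esub> (t \<odot>\<^bsub>M\<^esub> m) = u \<odot>\<^bsub>M\<^esub> (s \<odot>\<^bsub>M\<^esub> n))"
  by (simp add: fraction_rel_def)

text \<open>Reduces support to torsion by elements outside \<open>P\<close>; later arguments use
  only the torsion form.\<close>

lemma is_zero_localized_module_iff:
  assumes "module R N" "primeideal P R"
  shows "is_zero_module (localized_module R (carrier R - P) N) \<longleftrightarrow>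
    (\<forall>x\<in>carrier N. \<exists>s\<in>carrier R - P. s \<odot>\<^bsub>N\<^esub> x = \<zero>\<^bsub>N\<^esub>)" (is "?zero \<longleftrightarrow> ?torsion")
proof -
  interpret N: module R N by fact
  interpret P: primeideal P R by fact
  let ?S = "carrier R - P"
  let ?cls = "\<lambda>p. fraction_rel ?S N `` {p}"
  have one: "\<one>\<^bsub>R\<^esub> \<in> ?S" using P.I_notcarr P.one_imp_carrier by auto
  have mult: "s \<otimes>\<^bsub>R\<^esub> t \<in> ?S" if "s \<in> ?S" "t \<in> ?S" for s t using that P.I_prime by auto
  have zero: "is_zero_module (localized_module R ?S N) \<longleftrightarrow>
      (carrier N \<times> ?S) // fraction_rel ?S N = {?cls (\<zero>\<^bsub>N\<^esub>, \<one>\<^bsub>R\<^esub>)}"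
    by (simp add: is_zero_module_def localized_module_def)
  show ?thesis
  proof
    assume ?zero
    show ?torsion
    proof
      fix x assume x: "x \<in> carrier N"
      then have "?cls (x, \<one>\<^bsub>R\<^esub>) \<in> (carrier N \<times> ?S) // fraction_rel ?S N"
        using one by (intro quotientI) auto
      then have "?cls (x, \<one>\<^bsub>R\<^esub>) = ?cls (\<zero>\<^bsub>N\<^esub>, \<one>\<^bsub>R\<^esub>)"
        using \<open>?zero\<close> unfolding zero by simp
      moreover have "(x, \<one>\<^bsub>R\<^esub>) \<in> ?cls (x, \<one>\<^bsub>R\<^esub>)" using x one by (auto simp: fraction_rel_iff)
      ultimately obtain u where "u \<in> ?S" "u \<odot>\<^bsub>N\<^esub> (\<one>\<^bsub>R\<^esub> \<odot>\<^bsub>N\<^esub> \<zero>\<^bsub>N\<^esub>) = u \<odot>\<^bsub>N\<^esub> (\<one>\<^bsub>R\<^esub> \<odot>\<^bsub>N\<^esub> x)"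
        by (auto simp: fraction_rel_iff)
      then show "\<exists>s\<in>?S. s \<odot>\<^bsub>N\<^esub> x = \<zero>\<^bsub>N\<^esub>" using x by (auto intro!: bexI[of _ u])
    qed
  next
    assume tors: ?torsion
    have "?cls (x, s) = carrier N \<times> ?S" if x: "x \<in> carrier N" and s: "s \<in> ?S" for x s
    proof -
      have "((x, s), (y, t)) \<in> fraction_rel ?S N" if y: "y \<in> carrier N" and t: "t \<in> ?S" for y t
      proof -
        have "s \<odot>\<^bsub>N\<^esub> y \<in> carrier N" "t \<odot>\<^bsub>N\<^esub> x \<in> carrier N" using x y s t by auto
        then obtain u v where u: "u \<in> ?S" "u \<odot>\<^bsub>N\<^esub> (s \<odot>\<^bsub>N\<^esub> y) = \<zero>\<^bsub>N\<^esub>"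
          and v: "v \<in> ?S" "v \<odot>\<^bsub>N\<^esub> (t \<odot>\<^bsub>N\<^esub> x) = \<zero>\<^bsub>N\<^esub>" using tors by meson
        \<comment> \<open>The common multiplier of \<open>u\<close> and \<open>v\<close> kills both
          cross products, so any two fractions are related and there is only one class.\<close>
        have "(u \<otimes>\<^bsub>R\<^esub> v) \<odot>\<^bsub>N\<^esub> (t \<odot>\<^bsub>N\<^esub> x) = \<zero>\<^bsub>N\<^esub>"
          using u v x t by (simp add: N.smult_assoc1)
        moreover have "(u \<otimes>\<^bsub>R\<^esub> v) \<odot>\<^bsub>N\<^esub> (s \<odot>\<^bsub>N\<^esub> y) = \<zero>\<^bsub>N\<^esub>"
          using u v y s N.m_comm[of u v] by (simp add: N.smult_assoc1)
        ultimately show ?thesis using x y s t mult[OF u(1) v(1)] unfolding fraction_rel_iff by metis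
      qed
      then show ?thesis by (auto simp: fraction_rel_def)
    qed
    then have all: "?cls p = carrier N \<times> ?S" if "p \<in> carrier N \<times> ?S" for p using that by blast
    have mem: "(\<zero>\<^bsub>N\<^esub>, \<one>\<^bsub>R\<^esub>) \<in> carrier N \<times> ?S" using one by simp
    have "(carrier N \<times> ?S) // fraction_rel ?S N = {carrier N \<times> ?S}"
      unfolding quotient_def using all mem by blast
    then show ?zero unfolding zero using all[OF mem] by simp
  qed
qed

lemma Supp_iff:
  assumes "module R N"
  shows "P \<in> Supp R N \<longleftrightarrow>
    primeideal P R \<and> (\<exists>x\<in>carrier N. \<forall>s\<in>carrier R - P. s \<odot>\<^bsub>N\<^esub> x \<noteq> \<zero>\<^bsub>N\<^esub>)"
  using is_zero_localized_module_iff[OF assms] by (auto simp: Supp_def Spec_def)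

text \<open>The witness for \<open>P\<close> serves for \<open>Q\<close>, because the complement of
  \<open>Q\<close> is contained in that of \<open>P\<close>.\<close>

lemma Supp_upward_closed:
  assumes "module R N" "P \<in> Supp R N" "primeideal Q R" "P \<subseteq> Q"
  shows "Q \<in> Supp R N"
  using assms unfolding Supp_iff[OF assms(1)] by blast

lemma submodule_zero_closed: "submodule K R M \<Longrightarrow> \<zero>\<^bsub>M\<^esub> \<in> K"
  using subgroup.one_closed[of K "add_monoid M"] by (simp add: submodule_def)

lemma submodule_restrict_carrier:
  assumes "module R M" "submodule H R M" "submodule K R M" "H \<subseteq> K"
  shows "submodule H R (M\<lparr>carrier := K\<rparr>)"
proof -
  interpret M: module R M by fact
  have "subgroup H (add_monoid M\<lparr>carrier := K\<rparr>)"
    using assms by (intro M.add.subgroup_incl) (auto simp: submodule_def)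
  then show ?thesis
    using assms(2) by (simp add: submodule_def submodule_axioms_def)
qed

lemma linear_image_submodule:
  assumes "module R M" "module R N" "h \<in> linear_maps R M N"
  shows "submodule (h ` carrier M) R N"
proof -
  interpret M: module R M by fact
  interpret N: module R N by fact
  have "\<ominus>\<^bsub>N\<^esub> h x \<in> h ` carrier M" if "x \<in> carrier M" for x
    using that linear_maps_minus[OF assms that, symmetric] by auto
  moreover have "h x \<oplus>\<^bsub>N\<^esub> h y \<in> h ` carrier M" if "x \<in> carrier M" "y \<in> carrier M" for x y
    using that linear_maps_add[OF assms(3), symmetric] by auto
  moreover have "a \<odot>\<^bsub>N\<^esub> h x \<in> h ` carrier M" if "a \<in> carrier R" "x \<in> carrier M" for a x
    using that linear_maps_smult[OF assms(3), symmetric] by auto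
  moreover have "\<zero>\<^bsub>N\<^esub> \<in> h ` carrier M" using linear_maps_zero[OF assms] M.zero_closed by force
  ultimately show ?thesis
    using assms(3) by (intro N.submoduleI) auto
qed

lemma linear_preimage_submodule:
  assumes "module R M" "module R N" "h \<in> linear_maps R M N" "submodule K R N"
  shows "submodule {x \<in> carrier M. h x \<in> K} R M"
proof -
  interpret M: module R M by fact
  interpret N: module R N by fact
  note K = N.submoduleE[OF assms(4)]
  show ?thesis
    using assms(3) submodule_zero_closed[OF assms(4)] linear_maps_zero[OF assms(1-3)] linear_maps_minus[OF assms(1-3)] K(3-5)
    by (intro M.submoduleI) (auto simp: linear_maps_add linear_maps_smult)
qed

subsection \<open>Free modules\<close>

lemma free_module_simps [simp]:
  "\<zero>\<^bsub>free_module R B\<^esub> = (\<lambda>_. \<zero>\<^bsub>R\<^esub>)"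
  "f \<oplus>\<^bsub>free_module R B\<^esub> g = (\<lambda>i. f i \<oplus>\<^bsub>R\<^esub> g i)"
  "a \<odot>\<^bsub>free_module R B\<^esub> f = (\<lambda>i. a \<otimes>\<^bsub>R\<^esub> f i)"
  by (simp_all add: free_module_def)

lemma free_module_carrier_iff:
  "f \<in> carrier (free_module R B) \<longleftrightarrow>
    (\<forall>i. f i \<in> carrier R) \<and> finite {i. f i \<noteq> \<zero>\<^bsub>R\<^esub>} \<and> {i. f i \<noteq> \<zero>\<^bsub>R\<^esub>} \<subseteq> B"
  by (auto simp: free_module_def)

definition unit_vector :: "('a, 'x) ring_scheme \<Rightarrow> 'i \<Rightarrow> 'i \<Rightarrow> 'a" where
  "unit_vector R b = (\<lambda>i. if i = b then \<one>\<^bsub>R\<^esub> else \<zero>\<^bsub>R\<^esub>)"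

lemma (in cring) free_module_module: "module R (free_module R B)"
proof -
  have add: "(\<lambda>i. f i \<oplus> g i) \<in> carrier (free_module R B)"
    if f: "f \<in> carrier (free_module R B)" and g: "g \<in> carrier (free_module R B)" for f g
  proof -
    have "{i. f i \<oplus> g i \<noteq> \<zero>} \<subseteq> {i. f i \<noteq> \<zero>} \<union> {i. g i \<noteq> \<zero>}" by auto
    then show ?thesis using f g unfolding free_module_carrier_iff by (auto intro: finite_subset)
  qed
  have smult: "(\<lambda>i. a \<otimes> f i) \<in> carrier (free_module R B)"
    if a: "a \<in> carrier R" and f: "f \<in> carrier (free_module R B)" for a f
  proof -
    have "{i. a \<otimes> f i \<noteq> \<zero>} \<subseteq> {i. f i \<noteq> \<zero>}" using a by auto
    then show ?thesis using f a unfolding free_module_carrier_iff by (auto intro: finite_subset)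
  qed
  show ?thesis
  proof (intro moduleI abelian_groupI)
    fix f assume f: "f \<in> carrier (free_module R B)"
    have "(\<lambda>i. (\<ominus> \<one>) \<otimes> f i) \<in> carrier (free_module R B)" using f by (intro smult) auto
    then show "\<exists>g\<in>carrier (free_module R B). g \<oplus>\<^bsub>free_module R B\<^esub> f = \<zero>\<^bsub>free_module R B\<^esub>"
      using f by (intro bexI[of _ "\<lambda>i. (\<ominus> \<one>) \<otimes> f i"]) (auto simp: free_module_carrier_iff l_minus l_neg)
  next
    show "\<zero>\<^bsub>free_module R B\<^esub> \<in> carrier (free_module R B)" by (simp add: free_module_carrier_iff)
  qed (use add smult is_cring in \<open>auto simp: free_module_carrier_iff l_distr r_distr m_assoc a_ac\<close>)
qed

lemma (in cring) unit_vector_closed: "b \<in> B \<Longrightarrow> unit_vector R b \<in> carrier (free_module R B)"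
  by (auto simp: free_module_carrier_iff unit_vector_def)

text \<open>Coordinates are removed one at a time. Together with
  \<open>linear_preimage_submodule\<close> this reduces a claim about all values of a linear map to
  the unit vectors.\<close>

lemma (in cring) free_module_subset_submodule:
  assumes "submodule K R (free_module R B)" "\<And>b. b \<in> B \<Longrightarrow> unit_vector R b \<in> K"
  shows "carrier (free_module R B) \<subseteq> K"
proof
  interpret F: module R "free_module R B" by (rule free_module_module)
  note K = F.submoduleE[OF assms(1)]
  have zero: "(\<lambda>_. \<zero>) \<in> K" using submodule_zero_closed[OF assms(1)] by simp
  have "f \<in> K" if "finite S" "f \<in> carrier (free_module R B)" "{i. f i \<noteq> \<zero>} \<subseteq> S" for f S
    using that
  proof (induction S arbitrary: f)
    case empty
    then have "f = (\<lambda>_. \<zero>)" by auto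
    then show ?case using zero by simp
  next
    case (insert b S)
    have f: "\<And>i. f i \<in> carrier R" "finite {i. f i \<noteq> \<zero>}" "{i. f i \<noteq> \<zero>} \<subseteq> B"
      using insert.prems(1) by (auto simp: free_module_carrier_iff)
    show ?case
    proof (cases "f b = \<zero>")
      case True
      then show ?thesis using insert by blast
    next
      case False
      have supp: "{i. (f(b := \<zero>)) i \<noteq> \<zero>} \<subseteq> {i. f i \<noteq> \<zero>}" by auto
      have "f(b := \<zero>) \<in> carrier (free_module R B)"
        using f supp finite_subset[OF supp] unfolding free_module_carrier_iff by auto
      moreover have "{i. (f(b := \<zero>)) i \<noteq> \<zero>} \<subseteq> S" using insert.prems(2) by auto
      ultimately have "f(b := \<zero>) \<in> K" by (rule insert.IH)
      moreover have "f b \<odot>\<^bsub>free_module R B\<^esub> unit_vector R b \<in> K"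
        using K(4) assms(2) f False by blast
      ultimately have "f(b := \<zero>) \<oplus>\<^bsub>free_module R B\<^esub> f b \<odot>\<^bsub>free_module R B\<^esub> unit_vector R b \<in> K"
        by (rule K(5))
      moreover have "f(b := \<zero>) \<oplus>\<^bsub>free_module R B\<^esub> f b \<odot>\<^bsub>free_module R B\<^esub> unit_vector R b = f"
        using f(1) by (auto simp: unit_vector_def fun_eq_iff)
      ultimately show ?thesis by simp
    qed
  qed
  then show "f \<in> K" if "f \<in> carrier (free_module R B)" for f
    using that by (auto simp: free_module_carrier_iff)
qed

lemma free_module_linear_extension:
  assumes "module R N" "c \<in> B \<rightarrow> carrier N"
  shows "\<exists>h\<in>linear_maps R (free_module R B) N. \<forall>b\<in>B. h (unit_vector R b) = c b"
proof -
  interpret N: module R N by fact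
  interpret F: module R "free_module R B" by (rule N.free_module_module)
  have c: "c b \<in> carrier N" if "b \<in> B" for b using that assms(2) by blast
  define h where "h = (\<lambda>f\<in>carrier (free_module R B). \<Oplus>\<^bsub>N\<^esub>b\<in>{i. f i \<noteq> \<zero>\<^bsub>R\<^esub>}. f b \<odot>\<^bsub>N\<^esub> c b)"
  \<comment> \<open>The sum may be taken over any finite set between the support and
    \<open>B\<close>; additivity needs a common one for \<open>f\<close>, \<open>g\<close> and their
    sum.\<close>
  have h_eq: "h f = (\<Oplus>\<^bsub>N\<^esub>b\<in>S. f b \<odot>\<^bsub>N\<^esub> c b)"
    if f: "f \<in> carrier (free_module R B)" and S: "finite S" "{i. f i \<noteq> \<zero>\<^bsub>R\<^esub>} \<subseteq> S" "S \<subseteq> B" for f S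
    unfolding h_def restrict_def using f S assms(2)
    by (auto intro!: N.add.finprod_mono_neutral_cong_left simp: free_module_carrier_iff subset_iff Pi_iff)
  have "h \<in> linear_maps R (free_module R B) N"
  proof (rule linear_mapsI)
    show "h \<in> carrier (free_module R B) \<rightarrow>\<^sub>E carrier N"
      using assms(2) by (auto simp: h_def free_module_carrier_iff Pi_iff subset_iff intro!: N.finsum_closed)
  next
    fix f g assume f: "f \<in> carrier (free_module R B)" and g: "g \<in> carrier (free_module R B)"
    let ?S = "{i. f i \<noteq> \<zero>\<^bsub>R\<^esub>} \<union> {i. g i \<noteq> \<zero>\<^bsub>R\<^esub>}"
    have S: "finite ?S" "?S \<subseteq> B" using f g by (auto simp: free_module_carrier_iff)
    have terms: "(\<lambda>b. f b \<odot>\<^bsub>N\<^esub> c b) \<in> ?S \<rightarrow> carrier N" "(\<lambda>b. g b \<odot>\<^bsub>N\<^esub> c b) \<in> ?S \<rightarrow> carrier N"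
      using f g subsetD[OF S(2)] c by (auto simp: free_module_carrier_iff)
    have fg: "f \<oplus>\<^bsub>free_module R B\<^esub> g \<in> carrier (free_module R B)" using f g by (rule F.a_closed)
    have supp: "{i. (f \<oplus>\<^bsub>free_module R B\<^esub> g) i \<noteq> \<zero>\<^bsub>R\<^esub>} \<subseteq> ?S" by auto
    have "h (f \<oplus>\<^bsub>free_module R B\<^esub> g) = (\<Oplus>\<^bsub>N\<^esub>b\<in>?S. (f b \<oplus>\<^bsub>R\<^esub> g b) \<odot>\<^bsub>N\<^esub> c b)"
      using h_eq[OF fg S(1) supp S(2)] by simp
    also have "\<dots> = (\<Oplus>\<^bsub>N\<^esub>b\<in>?S. f b \<odot>\<^bsub>N\<^esub> c b \<oplus>\<^bsub>N\<^esub> g b \<odot>\<^bsub>N\<^esub> c b)"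
      using f g subsetD[OF S(2)] c
      by (intro N.finsum_cong') (auto simp: free_module_carrier_iff intro!: N.smult_l_distr)
    also have "\<dots> = h f \<oplus>\<^bsub>N\<^esub> h g"
      using N.finsum_addf[OF terms] h_eq[OF f S(1) _ S(2)] h_eq[OF g S(1) _ S(2)] by simp
    finally show "h (f \<oplus>\<^bsub>free_module R B\<^esub> g) = h f \<oplus>\<^bsub>N\<^esub> h g" .
  next
    fix a f assume a: "a \<in> carrier R" and f: "f \<in> carrier (free_module R B)"
    let ?S = "{i. f i \<noteq> \<zero>\<^bsub>R\<^esub>}"
    have S: "finite ?S" "?S \<subseteq> B" using f by (auto simp: free_module_carrier_iff)
    have terms: "(\<lambda>b. f b \<odot>\<^bsub>N\<^esub> c b) \<in> ?S \<rightarrow> carrier N"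
      using f subsetD[OF S(2)] c by (auto simp: free_module_carrier_iff)
    have af: "a \<odot>\<^bsub>free_module R B\<^esub> f \<in> carrier (free_module R B)" using a f by (rule F.smult_closed)
    have supp: "{i. (a \<odot>\<^bsub>free_module R B\<^esub> f) i \<noteq> \<zero>\<^bsub>R\<^esub>} \<subseteq> ?S" using a by auto
    have "h (a \<odot>\<^bsub>free_module R B\<^esub> f) = (\<Oplus>\<^bsub>N\<^esub>b\<in>?S. (a \<otimes>\<^bsub>R\<^esub> f b) \<odot>\<^bsub>N\<^esub> c b)"
      using h_eq[OF af S(1) supp S(2)] by simp
    also have "\<dots> = (\<Oplus>\<^bsub>N\<^esub>b\<in>?S. a \<odot>\<^bsub>N\<^esub> (f b \<odot>\<^bsub>N\<^esub> c b))"
      using a f subsetD[OF S(2)] c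
      by (intro N.finsum_cong') (auto simp: free_module_carrier_iff intro!: N.smult_assoc1)
    also have "\<dots> = a \<odot>\<^bsub>N\<^esub> h f"
      using N.finsum_smult_ldistr[OF S(1) a terms] h_eq[OF f S(1) _ S(2)] by simp
    finally show "h (a \<odot>\<^bsub>free_module R B\<^esub> f) = a \<odot>\<^bsub>N\<^esub> h f" .
  qed
  moreover have "h (unit_vector R b) = c b" if b: "b \<in> B" for b
  proof -
    have "h (unit_vector R b) = (\<Oplus>\<^bsub>N\<^esub>i\<in>{b}. unit_vector R b i \<odot>\<^bsub>N\<^esub> c i)"
      using b N.unit_vector_closed by (intro h_eq) (auto simp: unit_vector_def)
    also have "\<dots> = c b"
      using c[OF b] N.finsum_insert[of "{}" b "\<lambda>i. unit_vector R b i \<odot>\<^bsub>N\<^esub> c i"]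
      by (simp add: unit_vector_def)
    finally show ?thesis .
  qed
  ultimately show ?thesis by blast
qed

text \<open>There is one basis element for each element of \<open>K\<close>, so surjectivity is
  immediate. The encoding \<open>enc\<close> places the basis in a prescribed type, as all bases of
  a resolution must share one type.\<close>

lemma exists_free_cover:
  fixes enc :: "'n \<Rightarrow> 'i"
  assumes "module R N" "submodule K R N" "inj_on enc K"
  shows "\<exists>(B :: 'i set) h. h \<in> linear_maps R (free_module R B) N \<and> h ` carrier (free_module R B) = K"
proof -
  interpret N: module R N by fact
  interpret F: module R "free_module R (enc ` K)" by (rule N.free_module_module)
  let ?F = "free_module R (enc ` K)"
  have K: "K \<subseteq> carrier N" by (rule N.submoduleE(1)[OF assms(2)])
  have "inv_into K enc \<in> enc ` K \<rightarrow> carrier N" using K assms(3) by auto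
  from free_module_linear_extension[OF assms(1) this] obtain h where h: "h \<in> linear_maps R ?F N"
    and unit: "\<And>b. b \<in> enc ` K \<Longrightarrow> h (unit_vector R b) = inv_into K enc b"
    by blast
  have "carrier ?F \<subseteq> {f \<in> carrier ?F. h f \<in> K}"
    using linear_preimage_submodule[OF F.module_axioms assms(1) h assms(2)] assms(3)
    by (intro N.free_module_subset_submodule) (auto simp: unit N.unit_vector_closed)
  moreover have "K \<subseteq> h ` carrier ?F"
  proof
    fix k assume "k \<in> K"
    then have "h (unit_vector R (enc k)) = k" "unit_vector R (enc k) \<in> carrier ?F"
      using assms(3) by (auto simp: unit N.unit_vector_closed)
    then show "k \<in> h ` carrier ?F" by force
  qed
  ultimately show ?thesis using h by blast
qed

text \<open>A prefix code: each letter is preceded by the mark \<open>u\<close> and each word is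
  closed by \<open>v\<close>, so the next mark tells whether the word goes on.\<close>

lemma exists_inj_list_list:
  assumes "u \<noteq> (v :: 'b)"
  shows "\<exists>code :: 'b list list \<Rightarrow> 'b list. inj code"
proof -
  define esc where "esc w = concat (map (\<lambda>x. [u, x]) w)" for w :: "'b list"
  define code where "code ws = concat (map (\<lambda>w. esc w @ [v]) ws)" for ws
  have esc: "w = w' \<and> r = r'" if "esc w @ v # r = esc w' @ v # r'" for w w' r r'
    using that
  proof (induction w arbitrary: w')
    case Nil
    then show ?case using assms by (cases w') (auto simp: esc_def)
  next
    case (Cons x w)
    then show ?case using assms by (cases w') (auto simp: esc_def)
  qed
  have "ws = ws'" if "code ws = code ws'" for ws ws'
    using that
  proof (induction ws arbitrary: ws')
    case Nil
    then show ?case by (cases ws') (auto simp: code_def)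
  next
    case (Cons w ws)
    then obtain w' vs where ws': "ws' = w' # vs" by (cases ws') (auto simp: code_def)
    then have "esc w @ v # code ws = esc w' @ v # code vs" using Cons.prems by (simp add: code_def)
    then show ?case using esc Cons.IH ws' by blast
  qed
  then show ?thesis by (intro exI[of _ code] injI)
qed

text \<open>A finitely supported function is determined by its finite graph: a value put in front of
  its index is one word, the graph becomes a list of words, and the list is coded by a single word.
  Thus kernels inside a free module fit into the index type again.\<close>

lemma exists_inj_on_free_module:
  fixes R :: "('a, 'x) ring_scheme" and B :: "('a + 'm) list set"
  shows "\<exists>enc :: (('a + 'm) list \<Rightarrow> 'a) \<Rightarrow> ('a + 'm) list. inj_on enc (carrier (free_module R B))"
proof -
  obtain code :: "('a + 'm) list list \<Rightarrow> ('a + 'm) list" where code: "inj code"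
    using exists_inj_list_list[of "Inl undefined" "Inr undefined"] by auto
  define graph where "graph f = {Inl (f w) # w | w. f w \<noteq> \<zero>\<^bsub>R\<^esub>}" for f :: "('a + 'm) list \<Rightarrow> 'a"
  define enum where "enum f = (SOME ws. set ws = graph f)" for f :: "('a + 'm) list \<Rightarrow> 'a"
  have enum: "set (enum f) = graph f" if "f \<in> carrier (free_module R B)" for f
  proof -
    have "finite (graph f)" using that by (auto simp: graph_def free_module_carrier_iff)
    then show ?thesis unfolding enum_def by (rule someI_ex[OF finite_list])
  qed
  have "f = g" if fg: "f \<in> carrier (free_module R B)" "g \<in> carrier (free_module R B)"
    and "code (enum f) = code (enum g)" for f g
  proof
    fix w
    have "enum f = enum g" using that(3) code by (simp add: inj_eq)
    then have "graph f = graph g" using enum fg by metis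
    \<comment> \<open>A zero value leaves no trace in the graph, so the word of \<open>f\<close> and
      the word of \<open>g\<close> are both tested.\<close>
    then have "Inl (f w) # w \<in> graph f \<longleftrightarrow> Inl (f w) # w \<in> graph g"
      "Inl (g w) # w \<in> graph f \<longleftrightarrow> Inl (g w) # w \<in> graph g" by simp_all
    then show "f w = g w" unfolding graph_def by auto
  qed
  then show ?thesis by (intro exI[of _ "code \<circ> enum"] inj_onI) simp
qed

text \<open>Free covers are iterated. The state of the recursion is a basis together with the
  submodule of its free module onto which the next differential has to map.\<close>

lemma exists_free_resolution:
  fixes R :: "('a, 'x) ring_scheme" and M :: "('a, 'm, 'y) module_scheme"
  assumes "module R M"
  shows "\<exists>(B :: nat \<Rightarrow> ('a + 'm) list set) d e. free_resolution R M B d e"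
proof -
  interpret M: module R M by fact
  have free: "module R (free_module R B)" for B :: "('a + 'm) list set" by (rule M.free_module_module)
  obtain B0 :: "('a + 'm) list set" and e
    where e: "e \<in> linear_maps R (free_module R B0) M" "e ` carrier (free_module R B0) = carrier M"
    using exists_free_cover[OF assms M.carrier_is_submodule, of "\<lambda>m. [Inr m]"]
    by (auto simp: inj_on_def)
  define K0 where "K0 = a_kernel (free_module R B0) M e"
  define Q where "Q BK BK' d \<longleftrightarrow>
      d \<in> linear_maps R (free_module R (fst BK')) (free_module R (fst BK)) \<and>
      d ` carrier (free_module R (fst BK')) = snd BK \<and>
      snd BK' = a_kernel (free_module R (fst BK')) (free_module R (fst BK)) d"
    for BK BK' :: "('a + 'm) list set \<times> (('a + 'm) list \<Rightarrow> 'a) set" and d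
  have "\<exists>BK. \<forall>n. (submodule (snd (BK n)) R (free_module R (fst (BK n))) \<and> (n = 0 \<longrightarrow> BK n = (B0, K0))) \<and>
      (\<exists>d. Q (BK n) (BK (Suc n)) d)"
  proof (rule dependent_nat_choice)
    show "\<exists>x. submodule (snd x) R (free_module R (fst x)) \<and> (0 = 0 \<longrightarrow> x = (B0, K0))"
      using a_kernel_submodule[OF free assms e(1)] by (auto simp: K0_def)
  next
    fix BK :: "('a + 'm) list set \<times> (('a + 'm) list \<Rightarrow> 'a) set" and n :: nat
    assume "submodule (snd BK) R (free_module R (fst BK)) \<and> (n = 0 \<longrightarrow> BK = (B0, K0))"
    then have sub: "submodule (snd BK) R (free_module R (fst BK))" ..
    obtain enc :: "(('a + 'm) list \<Rightarrow> 'a) \<Rightarrow> ('a + 'm) list"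
      where "inj_on enc (carrier (free_module R (fst BK)))" using exists_inj_on_free_module by blast
    then have "inj_on enc (snd BK)" using module.submoduleE(1)[OF free sub] by (rule inj_on_subset)
    from exists_free_cover[OF free sub this] obtain B :: "('a + 'm) list set" and d
      where "d \<in> linear_maps R (free_module R B) (free_module R (fst BK))"
      "d ` carrier (free_module R B) = snd BK" by blast
    then have "submodule (a_kernel (free_module R B) (free_module R (fst BK)) d) R (free_module R B)"
      "Q BK (B, a_kernel (free_module R B) (free_module R (fst BK)) d) d"
      using a_kernel_submodule[OF free free] by (auto simp: Q_def)
    then show "\<exists>BK'. (submodule (snd BK') R (free_module R (fst BK')) \<and> (Suc n = 0 \<longrightarrow> BK' = (B0, K0))) \<and>
        (\<exists>d. Q BK BK' d)"
      by (intro exI[of _ "(B, a_kernel (free_module R B) (free_module R (fst BK)) d)"]) auto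
  qed
  then obtain BK where BK: "BK 0 = (B0, K0)" "\<forall>n. \<exists>d. Q (BK n) (BK (Suc n)) d" by blast
  from choice[OF BK(2)] obtain d where "\<forall>n. Q (BK n) (BK (Suc n)) (d n)" by blast
  then have "free_resolution R M (\<lambda>n. fst (BK n)) d e"
    using e BK(1) unfolding free_resolution_def Q_def Let_def by (auto simp: K0_def)
  then show ?thesis by blast
qed

subsection \<open>Cohomology of Hom complexes\<close>

definition hom_cocycles where
  "hom_cocycles R F d N n =
    {h \<in> linear_maps R (F n) N. \<forall>f\<in>carrier (F (Suc n)). h (d n f) = \<zero>\<^bsub>N\<^esub>}"

definition hom_coboundaries where
  "hom_coboundaries R F d N n = (case n of
      0 \<Rightarrow> {\<lambda>f\<in>carrier (F 0). \<zero>\<^bsub>N\<^esub>}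
    | Suc k \<Rightarrow> (\<lambda>h. compose (carrier (F (Suc k))) h (d k)) ` linear_maps R (F k) N)"

lemma restrict_eq_iff: "restrict f A = restrict g A \<longleftrightarrow> (\<forall>x\<in>A. f x = g x)"
  by (metis restrict_apply' restrict_ext)

lemma hom_cohomology_eq:
  "hom_cohomology R F d N n =
    quotient_module ((Hom R (F n) N)\<lparr>carrier := hom_cocycles R F d N n\<rparr>) (hom_coboundaries R F d N n)"
proof -
  have "a_kernel (Hom R (F n) N) (Hom R (F (Suc n)) N) (\<lambda>h. compose (carrier (F (Suc n))) h (d n)) =
      hom_cocycles R F d N n"
    by (auto simp: a_kernel_iff hom_cocycles_def compose_def restrict_eq_iff)
  then show ?thesis
    by (cases n) (simp_all add: hom_cohomology_def hom_coboundaries_def Let_def)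
qed

locale free_complex = cring R for R :: "('a, 'x) ring_scheme" (structure) +
  fixes B :: "nat \<Rightarrow> 'i set" and d :: "nat \<Rightarrow> ('i \<Rightarrow> 'a) \<Rightarrow> ('i \<Rightarrow> 'a)"
  assumes d_linear: "d n \<in> linear_maps R (free_module R (B (Suc n))) (free_module R (B n))"
    and d_d: "f \<in> carrier (free_module R (B (Suc (Suc n)))) \<Longrightarrow> d n (d (Suc n) f) = (\<lambda>_. \<zero>)"
begin

abbreviation F :: "nat \<Rightarrow> ('a, 'i \<Rightarrow> 'a) module" where
  "F n \<equiv> free_module R (B n)"

abbreviation cochains :: "nat \<Rightarrow> (('i \<Rightarrow> 'a) \<Rightarrow> 'a) set" where
  "cochains n \<equiv> linear_maps R (F n) (ring_module R)"

abbreviation cocycles :: "nat \<Rightarrow> (('i \<Rightarrow> 'a) \<Rightarrow> 'a) set" where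
  "cocycles \<equiv> hom_cocycles R F d (ring_module R)"

abbreviation coboundaries :: "nat \<Rightarrow> (('i \<Rightarrow> 'a) \<Rightarrow> 'a) set" where
  "coboundaries \<equiv> hom_coboundaries R F d (ring_module R)"

lemma cochains_closed [simp]: "h \<in> cochains n \<Longrightarrow> f \<in> carrier (F n) \<Longrightarrow> h f \<in> carrier R"
  using linear_maps_closed[of h R "F n" "ring_module R"] by simp

lemma d_closed [simp]: "f \<in> carrier (F (Suc n)) \<Longrightarrow> d n f \<in> carrier (F n)"
  using linear_maps_closed[OF d_linear] .

lemma cochain_zero: "h \<in> cochains n \<Longrightarrow> h (\<lambda>_. \<zero>) = \<zero>"
  using linear_maps_zero[OF free_module_module ring_module_module, of h] by simp

text \<open>This form covers the cochains built later: scalar multiples, the error of a lift, and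
  the corrected cochain in the connecting argument.\<close>

lemma cochains_combination:
  assumes "h \<in> cochains n" "k \<in> cochains n" "a \<in> carrier R" "b \<in> carrier R"
  shows "(\<lambda>f\<in>carrier (F n). a \<otimes> h f \<ominus> b \<otimes> k f) \<in> cochains n"
proof -
  interpret F: module R "F n" by (rule free_module_module)
  have 1: "h (f \<oplus>\<^bsub>F n\<^esub> g) = h f \<oplus> h g" "k (f \<oplus>\<^bsub>F n\<^esub> g) = k f \<oplus> k g"
    if "f \<in> carrier (F n)" "g \<in> carrier (F n)" for f g
    using linear_maps_add[of h R "F n" "ring_module R" f g] linear_maps_add[of k R "F n" "ring_module R" f g]
      assms that by simp_all
  have 2: "h (c \<odot>\<^bsub>F n\<^esub> f) = c \<otimes> h f" "k (c \<odot>\<^bsub>F n\<^esub> f) = c \<otimes> k f"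
    if "c \<in> carrier R" "f \<in> carrier (F n)" for c f
    using linear_maps_smult[of h R "F n" "ring_module R" c f] linear_maps_smult[of k R "F n" "ring_module R" c f]
      assms that by simp_all
  show ?thesis
  proof (rule linear_mapsI)
    fix f g assume f: "f \<in> carrier (F n)" and g: "g \<in> carrier (F n)"
    have "a \<otimes> (h f \<oplus> h g) \<ominus> b \<otimes> (k f \<oplus> k g) = (a \<otimes> h f \<ominus> b \<otimes> k f) \<oplus> (a \<otimes> h g \<ominus> b \<otimes> k g)"
      using assms cochains_closed[OF assms(1) f] cochains_closed[OF assms(2) f]
        cochains_closed[OF assms(1) g] cochains_closed[OF assms(2) g] by algebra
    then show "(\<lambda>f\<in>carrier (F n). a \<otimes> h f \<ominus> b \<otimes> k f) (f \<oplus>\<^bsub>F n\<^esub> g) =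
        (\<lambda>f\<in>carrier (F n). a \<otimes> h f \<ominus> b \<otimes> k f) f \<oplus>\<^bsub>ring_module R\<^esub>
        (\<lambda>f\<in>carrier (F n). a \<otimes> h f \<ominus> b \<otimes> k f) g"
      using f g F.a_closed[OF f g] 1[OF f g] by (simp del: free_module_simps)
  next
    fix c f assume c: "c \<in> carrier R" and f: "f \<in> carrier (F n)"
    have "a \<otimes> (c \<otimes> h f) \<ominus> b \<otimes> (c \<otimes> k f) = c \<otimes> (a \<otimes> h f \<ominus> b \<otimes> k f)"
      using assms c cochains_closed[OF assms(1) f] cochains_closed[OF assms(2) f] by algebra
    then show "(\<lambda>f\<in>carrier (F n). a \<otimes> h f \<ominus> b \<otimes> k f) (c \<odot>\<^bsub>F n\<^esub> f) =
        c \<odot>\<^bsub>ring_module R\<^esub> (\<lambda>f\<in>carrier (F n). a \<otimes> h f \<ominus> b \<otimes> k f) f"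
      using c f F.smult_closed[OF c f] 2[OF c f] by (simp del: free_module_simps)
  qed (use assms in auto)
qed

lemma cochains_smult:
  assumes "h \<in> cochains n" "a \<in> carrier R"
  shows "(\<lambda>f\<in>carrier (F n). a \<otimes> h f) \<in> cochains n"
proof -
  have "a \<otimes> h f \<ominus> \<zero> \<otimes> h f = a \<otimes> h f" if "f \<in> carrier (F n)" for f
    using assms cochains_closed[OF assms(1) that] by (simp add: minus_eq)
  then have "(\<lambda>f\<in>carrier (F n). a \<otimes> h f \<ominus> \<zero> \<otimes> h f) = (\<lambda>f\<in>carrier (F n). a \<otimes> h f)"
    by (intro restrict_ext) auto
  then show ?thesis using cochains_combination[OF assms(1,1,2), of \<zero>] by simp
qed

lemma coboundary_zero: "(\<lambda>f\<in>carrier (F 0). \<zero>) \<in> cochains 0"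
proof -
  interpret H: module R "Hom R (F 0) (ring_module R)"
    by (intro Hom_module free_module_module ring_module_module)
  show ?thesis using H.M.zero_closed by simp
qed

lemma coboundaries_subset_cocycles: "coboundaries n \<subseteq> cocycles n"
proof (cases n)
  case 0
  then show ?thesis using coboundary_zero by (simp add: hom_coboundaries_def hom_cocycles_def)
next
  case (Suc k)
  have "compose (carrier (F (Suc k))) h (d k) \<in> cochains (Suc k)" if "h \<in> cochains k" for h
    by (rule linear_maps_compose[OF that d_linear free_module_module])
  then show ?thesis
    using Suc by (auto simp: hom_coboundaries_def hom_cocycles_def compose_def d_d cochain_zero)
qed

lemma coboundaries_cochains: "c \<in> coboundaries n \<Longrightarrow> c \<in> cochains n"
  using coboundaries_subset_cocycles by (auto simp: hom_cocycles_def)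

text \<open>Restricted to cochains so that it is extensional and belongs to
  \<open>linear_maps\<close>; the general lemmas on kernels and images then show that cocycles and
  coboundaries are submodules.\<close>

definition codifferential :: "nat \<Rightarrow> (('i \<Rightarrow> 'a) \<Rightarrow> 'a) \<Rightarrow> (('i \<Rightarrow> 'a) \<Rightarrow> 'a)" where
  "codifferential n = (\<lambda>h\<in>cochains n. compose (carrier (F (Suc n))) h (d n))"

lemma codifferential_linear:
  "codifferential n \<in> linear_maps R (Hom R (F n) (ring_module R)) (Hom R (F (Suc n)) (ring_module R))"
proof -
  interpret H: module R "Hom R (F n) (ring_module R)"
    by (intro Hom_module free_module_module ring_module_module)
  have comp: "compose (carrier (F (Suc n))) h (d n) \<in> cochains (Suc n)" if "h \<in> cochains n" for h
    by (rule linear_maps_compose[OF that d_linear free_module_module])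
  show ?thesis
  proof (rule linear_mapsI)
    fix h k assume hk: "h \<in> carrier (Hom R (F n) (ring_module R))" "k \<in> carrier (Hom R (F n) (ring_module R))"
    have "(\<lambda>x\<in>carrier (F n). h x \<oplus> k x) \<in> cochains n" using H.M.a_closed[OF hk] by simp
    then show "codifferential n (h \<oplus>\<^bsub>Hom R (F n) (ring_module R)\<^esub> k) =
        codifferential n h \<oplus>\<^bsub>Hom R (F (Suc n)) (ring_module R)\<^esub> codifferential n k"
      using hk by (auto simp: codifferential_def compose_def fun_eq_iff)
  next
    fix a h assume ah: "a \<in> carrier R" "h \<in> carrier (Hom R (F n) (ring_module R))"
    have "(\<lambda>x\<in>carrier (F n). a \<otimes> h x) \<in> cochains n" using H.smult_closed[OF ah] by simp
    then show "codifferential n (a \<odot>\<^bsub>Hom R (F n) (ring_module R)\<^esub> h) =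
        a \<odot>\<^bsub>Hom R (F (Suc n)) (ring_module R)\<^esub> codifferential n h"
      using ah by (auto simp: codifferential_def compose_def fun_eq_iff)
  qed (use comp in \<open>auto simp: codifferential_def\<close>)
qed

lemma cocycles_submodule: "submodule (cocycles n) R (Hom R (F n) (ring_module R))"
proof -
  have "cocycles n = a_kernel (Hom R (F n) (ring_module R)) (Hom R (F (Suc n)) (ring_module R)) (codifferential n)"
    by (auto simp: a_kernel_iff hom_cocycles_def codifferential_def compose_def restrict_eq_iff)
  then show ?thesis
    using a_kernel_submodule[OF _ _ codifferential_linear]
    by (simp add: Hom_module free_module_module ring_module_module)
qed

lemma coboundaries_submodule: "submodule (coboundaries n) R (Hom R (F n) (ring_module R))"
proof (cases n)
  case 0
  interpret H: module R "Hom R (F 0) (ring_module R)"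
    by (intro Hom_module free_module_module ring_module_module)
  have "submodule {\<zero>\<^bsub>Hom R (F 0) (ring_module R)\<^esub>} R (Hom R (F 0) (ring_module R))"
    by (intro H.submoduleI) (auto simp del: Hom_simps)
  then show ?thesis using 0 by (simp add: hom_coboundaries_def)
next
  case (Suc k)
  have "coboundaries n = codifferential k ` carrier (Hom R (F k) (ring_module R))"
    using Suc by (auto simp: hom_coboundaries_def codifferential_def)
  then show ?thesis
    using linear_image_submodule[OF _ _ codifferential_linear, of k] Suc
    by (simp add: Hom_module free_module_module ring_module_module)
qed

lemma
  shows cocycles_module: "module R ((Hom R (F n) (ring_module R))\<lparr>carrier := cocycles n\<rparr>)"
    and coboundaries_submodule_cocycles:
      "submodule (coboundaries n) R ((Hom R (F n) (ring_module R))\<lparr>carrier := cocycles n\<rparr>)"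
  using submodule.submodule_is_module[OF cocycles_submodule]
    submodule_restrict_carrier[OF _ coboundaries_submodule cocycles_submodule coboundaries_subset_cocycles]
  by (simp_all add: Hom_module free_module_module ring_module_module)

lemma cohomology_module: "module R (hom_cohomology R F d (ring_module R) n)"
  unfolding hom_cohomology_eq
  by (rule quotient_module_module[OF cocycles_module coboundaries_submodule_cocycles])

text \<open>Descends from classes to cochains: if \<open>s\<close> kills the class of
  \<open>h\<close>, the coset of the multiple of \<open>h\<close> by \<open>s\<close> is the zero
  coset, and a coset contains its representative.\<close>

lemma multiple_coboundary:
  assumes "\<And>X. X \<in> carrier (hom_cohomology R F d (ring_module R) n) \<Longrightarrow>
      \<exists>s\<in>S. s \<odot>\<^bsub>hom_cohomology R F d (ring_module R) n\<^esub> X = \<zero>\<^bsub>hom_cohomology R F d (ring_module R) n\<^esub>"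
    and "S \<subseteq> carrier R" and h: "h \<in> cocycles n"
  shows "\<exists>s\<in>S. (\<lambda>f\<in>carrier (F n). s \<otimes> h f) \<in> coboundaries n"
proof -
  let ?Z = "(Hom R (F n) (ring_module R))\<lparr>carrier := cocycles n\<rparr>"
  interpret Z: module R ?Z by (rule cocycles_module)
  interpret H: abelian_subgroup "coboundaries n" ?Z
    using cocycles_module coboundaries_submodule_cocycles by (rule submodule_abelian_subgroup)
  let ?X = "coboundaries n +>\<^bsub>?Z\<^esub> h"
  have "?X \<in> carrier (hom_cohomology R F d (ring_module R) n)"
    using h by (auto simp: hom_cohomology_eq A_RCOSETS_def')
  then obtain s where s: "s \<in> S" "s \<odot>\<^bsub>quotient_module ?Z (coboundaries n)\<^esub> ?X = coboundaries n"
    using assms(1)[of ?X] by (auto simp: hom_cohomology_eq)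
  have sR: "s \<in> carrier R" using s assms(2) by blast
  have hZ: "h \<in> carrier ?Z" using h by simp
  have "coboundaries n +>\<^bsub>?Z\<^esub> (s \<odot>\<^bsub>?Z\<^esub> h) = coboundaries n"
    using s(2) quotient_module_smult_coset[OF cocycles_module coboundaries_submodule_cocycles sR hZ]
    by simp
  then have "s \<odot>\<^bsub>?Z\<^esub> h \<in> coboundaries n"
    using H.a_rcos_self[OF Z.smult_closed[OF sR hZ]] by simp
  then show ?thesis using s(1) by auto
qed

end

subsection \<open>Regular elements and chains of primes\<close>

lemma (in cring) submodule_ring_module_iff: "submodule I R (ring_module R) \<longleftrightarrow> ideal I R"
proof
  interpret M: module R "ring_module R" by (rule ring_module_module)
  show "ideal I R" if "submodule I R (ring_module R)"
    using M.submoduleE[OF that] submodule_zero_closed[OF that] by (intro ideal_cringI) auto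
  show "submodule I R (ring_module R)" if "ideal I R"
  proof -
    interpret I: ideal I R by fact
    show ?thesis
    proof (rule M.submoduleI)
      fix a assume a: "a \<in> I"
      then have "\<ominus>\<^bsub>ring_module R\<^esub> a = \<ominus>\<^bsub>ring_module R\<^esub> (\<one> \<odot>\<^bsub>ring_module R\<^esub> a)"
        by (simp add: I.Icarr)
      also have "\<dots> = (\<ominus> \<one>) \<otimes> a"
        using M.smult_l_minus[of \<one> a] a by (simp add: I.Icarr)
      finally show "\<ominus>\<^bsub>ring_module R\<^esub> a \<in> I" using a I.I_l_closed by simp
    qed (auto simp: I.Icarr I.I_l_closed)
  qed
qed

locale noetherian_free_complex = noetherian_cring R + free_complex R B d
  for R :: "('a, 'x) ring_scheme" (structure)
    and B :: "nat \<Rightarrow> 'i set" and d :: "nat \<Rightarrow> ('i \<Rightarrow> 'a) \<Rightarrow> ('i \<Rightarrow> 'a)"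
begin

text \<open>For a \<open>P\<close>-saturated ideal \<open>I\<close> this says that the localization at \<open>P\<close> of the \<open>n\<close>-th cohomology
  of \<open>Hom(F, R/I)\<close> vanishes: cochains with values in \<open>R/I\<close> are represented by their lifts to \<open>R\<close>,
  which exist because the \<open>F n\<close> are free.\<close>

definition locally_exact :: "'a set \<Rightarrow> 'a set \<Rightarrow> nat \<Rightarrow> bool" where
  "locally_exact P I n \<longleftrightarrow>
    (\<forall>h\<in>cochains n. (\<forall>f\<in>carrier (F (Suc n)). h (d n f) \<in> I) \<longrightarrow>
      (\<exists>s\<in>carrier R - P. \<exists>c\<in>coboundaries n. \<forall>f\<in>carrier (F n). s \<otimes> h f \<ominus> c f \<in> I))"

lemma locally_exactD:
  assumes "locally_exact P I n" "h \<in> cochains n" "\<And>f. f \<in> carrier (F (Suc n)) \<Longrightarrow> h (d n f) \<in> I"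
  obtains s c where "s \<in> carrier R - P" "c \<in> coboundaries n"
    "\<And>f. f \<in> carrier (F n) \<Longrightarrow> s \<otimes> h f \<ominus> c f \<in> I"
proof -
  from assms have "\<exists>s\<in>carrier R - P. \<exists>c\<in>coboundaries n. \<forall>f\<in>carrier (F n). s \<otimes> h f \<ominus> c f \<in> I"
    unfolding locally_exact_def by simp
  then show thesis by (elim bexE) (rule that, auto)
qed

text \<open>Freeness at work: coefficients of \<open>x\<close> are chosen on the basis and extended
  linearly, so ambiguity in dividing by \<open>x\<close> does no harm. The error is linear and lies
  in \<open>I\<close> on the basis, hence everywhere.\<close>

lemma lift_cochain:
  assumes "ideal I R" "x \<in> carrier R" "g \<in> cochains n"
    and "\<And>f. f \<in> carrier (F n) \<Longrightarrow> g f \<in> adjoin_multiples R I x"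
  shows "\<exists>k\<in>cochains n. \<forall>f\<in>carrier (F n). g f \<ominus> x \<otimes> k f \<in> I"
proof -
  interpret I: ideal I R by fact
  have "\<exists>r\<in>carrier R. g (unit_vector R b) \<ominus> x \<otimes> r \<in> I" if b: "b \<in> B n" for b
  proof -
    obtain i r where ir: "i \<in> I" "r \<in> carrier R" "g (unit_vector R b) = i \<oplus> x \<otimes> r"
      using assms(4)[OF unit_vector_closed[OF b]] by (auto simp: adjoin_multiples_def)
    have "i \<oplus> x \<otimes> r \<ominus> x \<otimes> r = i" using ir assms(2) I.Icarr[OF ir(1)] by algebra
    then show ?thesis using ir by (intro bexI[of _ r]) simp_all
  qed
  then obtain c where c: "\<And>b. b \<in> B n \<Longrightarrow> c b \<in> carrier R"
    "\<And>b. b \<in> B n \<Longrightarrow> g (unit_vector R b) \<ominus> x \<otimes> c b \<in> I" by metis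
  have "c \<in> B n \<rightarrow> carrier (ring_module R)" using c by auto
  from free_module_linear_extension[OF ring_module_module this]
  obtain k where k: "k \<in> cochains n" "\<And>b. b \<in> B n \<Longrightarrow> k (unit_vector R b) = c b" by blast
  let ?e = "\<lambda>f\<in>carrier (F n). \<one> \<otimes> g f \<ominus> x \<otimes> k f"
  have e: "?e \<in> cochains n" using cochains_combination[OF assms(3) k(1) one_closed assms(2)] .
  have "submodule I R (ring_module R)" using assms(1) by (simp add: submodule_ring_module_iff)
  then have "submodule {f \<in> carrier (F n). ?e f \<in> I} R (F n)"
    by (rule linear_preimage_submodule[OF free_module_module ring_module_module e])
  then have "carrier (F n) \<subseteq> {f \<in> carrier (F n). ?e f \<in> I}"
    using c k assms(3) by (intro free_module_subset_submodule) (auto simp: unit_vector_closed)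
  then have "g f \<ominus> x \<otimes> k f \<in> I" if "f \<in> carrier (F n)" for f
    using that assms(3) by (auto simp: subset_iff)
  then show ?thesis using k(1) by blast
qed

text \<open>Makes \<open>uniform_multiplier\<close> applicable: one multiplier serves all
  boundaries, even if \<open>F (Suc n)\<close> has infinite rank.\<close>

lemma values_on_boundaries_ideal:
  assumes "h \<in> cochains n"
  shows "ideal ((\<lambda>f. h (d n f)) ` carrier (F (Suc n))) R"
proof -
  have "compose (carrier (F (Suc n))) h (d n) \<in> cochains (Suc n)"
    by (rule linear_maps_compose[OF assms d_linear free_module_module])
  then have "ideal (compose (carrier (F (Suc n))) h (d n) ` carrier (F (Suc n))) R"
    using linear_image_submodule[OF free_module_module ring_module_module]
    by (simp add: submodule_ring_module_iff)
  then show ?thesis by (simp add: compose_def cong: image_cong)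
qed

text \<open>Start of the induction. A cocycle modulo the kernel of \<open>R -> R_P\<close> becomes a
  true cocycle after multiplication by one \<open>s\<close>, and the torsion hypothesis then
  provides \<open>t\<close>; the multiplier is their product.\<close>

lemma locally_exact_zero:
  assumes "primeideal P R"
    and "\<And>h. h \<in> cocycles n \<Longrightarrow>
      \<exists>s\<in>carrier R - P. (\<lambda>f\<in>carrier (F n). s \<otimes> h f) \<in> coboundaries n"
  shows "locally_exact P (saturation R P {\<zero>}) n"
  unfolding locally_exact_def
proof (intro ballI impI)
  interpret P: primeideal P R by fact
  fix h assume h: "h \<in> cochains n"
    and hd: "\<forall>f\<in>carrier (F (Suc n)). h (d n f) \<in> saturation R P {\<zero>}"
  have "\<exists>s\<in>carrier R - P. \<forall>a\<in>(\<lambda>f. h (d n f)) ` carrier (F (Suc n)). s \<otimes> a \<in> {\<zero>}"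
    using hd by (intro uniform_multiplier[OF assms(1) values_on_boundaries_ideal[OF h] zeroideal])
      (auto simp: saturation_def)
  then obtain s where s: "s \<in> carrier R - P" "\<And>f. f \<in> carrier (F (Suc n)) \<Longrightarrow> s \<otimes> h (d n f) = \<zero>"
    by auto
  have "(\<lambda>f\<in>carrier (F n). s \<otimes> h f) \<in> cocycles n"
    using s h cochains_smult[OF h, of s] by (auto simp: hom_cocycles_def)
  from assms(2)[OF this] obtain t where t: "t \<in> carrier R - P"
    "(\<lambda>f\<in>carrier (F n). t \<otimes> (\<lambda>f\<in>carrier (F n). s \<otimes> h f) f) \<in> coboundaries n" by blast
  define c where "c = (\<lambda>f\<in>carrier (F n). t \<otimes> (\<lambda>f\<in>carrier (F n). s \<otimes> h f) f)"
  have "\<zero> \<in> saturation R P {\<zero>}"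
    using saturation_superset[OF zeroideal assms(1)] by simp
  then have "(t \<otimes> s) \<otimes> h f \<ominus> c f \<in> saturation R P {\<zero>}" if "f \<in> carrier (F n)" for f
    using that s(1) t(1) h by (simp add: c_def m_assoc minus_eq r_neg)
  moreover have "t \<otimes> s \<in> carrier R - P" using s(1) t(1) P.I_prime by auto
  ultimately show "\<exists>s\<in>carrier R - P. \<exists>c\<in>coboundaries n.
      \<forall>f\<in>carrier (F n). s \<otimes> h f \<ominus> c f \<in> saturation R P {\<zero>}"
    using t(2) unfolding c_def[symmetric] by blast
qed

text \<open>The long exact cohomology sequence of \<open>0 \<rightarrow> R/I \<rightarrow> R/I \<rightarrow> R/(I + xR) \<rightarrow> 0\<close>.\<close>

lemma locally_exact_quotient:
  assumes P: "primeideal P R" and I: "ideal I R" and x: "x \<in> carrier R"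
    and regular: "\<And>a. a \<in> carrier R \<Longrightarrow> x \<otimes> a \<in> I \<Longrightarrow> a \<in> I"
    and exact: "locally_exact P I n" "locally_exact P I (Suc n)"
  shows "locally_exact P (saturation R P (adjoin_multiples R I x)) n"
  unfolding locally_exact_def
proof (intro ballI impI)
  interpret P: primeideal P R by fact
  interpret I: ideal I R by fact
  let ?J = "adjoin_multiples R I x"
  have J: "ideal ?J R" by (rule adjoin_multiples_ideal[OF I x])
  fix h assume h: "h \<in> cochains n"
    and hd: "\<forall>f\<in>carrier (F (Suc n)). h (d n f) \<in> saturation R P ?J"
  \<comment> \<open>One multiplier brings all values on boundaries from the saturation into
    \<open>I + xR\<close>.\<close>
  have "\<exists>s\<in>carrier R - P. \<forall>a\<in>(\<lambda>f. h (d n f)) ` carrier (F (Suc n)). s \<otimes> a \<in> ?J"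
    using hd by (intro uniform_multiplier[OF P values_on_boundaries_ideal[OF h] J])
      (auto simp: saturation_def)
  then obtain s where s: "s \<in> carrier R" "s \<notin> P"
    and shd: "\<And>f. f \<in> carrier (F (Suc n)) \<Longrightarrow> s \<otimes> h (d n f) \<in> ?J" by auto
  define g where "g = (\<lambda>f\<in>carrier (F (Suc n)). s \<otimes> compose (carrier (F (Suc n))) h (d n) f)"
  have g: "g \<in> cochains (Suc n)"
    unfolding g_def by (rule cochains_smult[OF linear_maps_compose[OF h d_linear free_module_module] s(1)])
  have g_eq: "g f = s \<otimes> h (d n f)" if "f \<in> carrier (F (Suc n))" for f
    using that by (simp add: g_def compose_def)
  \<comment> \<open>\<open>k\<close> represents the image of the class of \<open>h\<close> under the
    connecting map, up to the factor \<open>s\<close>: the coboundary of \<open>h\<close> times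
    \<open>s\<close> is \<open>x \<otimes> k\<close> modulo \<open>I\<close>.\<close>
  obtain k where k: "k \<in> cochains (Suc n)"
    and gk: "\<And>f. f \<in> carrier (F (Suc n)) \<Longrightarrow> g f \<ominus> x \<otimes> k f \<in> I"
    using lift_cochain[OF I x g] shd g_eq by auto
  \<comment> \<open>Modulo \<open>I\<close> the multiple \<open>x \<otimes> k\<close> is a
    coboundary, so it vanishes on boundaries; regularity cancels \<open>x\<close>.\<close>
  have "k (d (Suc n) f) \<in> I" if f: "f \<in> carrier (F (Suc (Suc n)))" for f
  proof -
    have kf: "k (d (Suc n) f) \<in> carrier R" using k f by simp
    have "g (d (Suc n) f) = \<zero>" using f g_eq[of "d (Suc n) f"] d_d[OF f] cochain_zero[OF h] s by simp
    then have "\<zero> \<ominus> x \<otimes> k (d (Suc n) f) \<in> I" using gk[of "d (Suc n) f"] f by simp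
    then have "\<ominus> (\<zero> \<ominus> x \<otimes> k (d (Suc n) f)) \<in> I" by (rule I.a_inv_closed)
    moreover have "\<ominus> (\<zero> \<ominus> x \<otimes> k (d (Suc n) f)) = x \<otimes> k (d (Suc n) f)" using x kf by algebra
    ultimately show ?thesis using regular[OF kf] by simp
  qed
  from locally_exactD[OF exact(2) k this] obtain t c
    where t: "t \<in> carrier R - P" and c: "c \<in> coboundaries (Suc n)"
      and tk: "\<And>f. f \<in> carrier (F (Suc n)) \<Longrightarrow> t \<otimes> k f \<ominus> c f \<in> I" by blast
  obtain l where l: "l \<in> cochains n" and cl: "c = compose (carrier (F (Suc n))) l (d n)"
    using c by (auto simp: hom_coboundaries_def)
  have tR: "t \<in> carrier R" using t by simp
  \<comment> \<open>By exactness in degree \<open>Suc n\<close>, \<open>t \<otimes> k\<close> is the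
    coboundary of \<open>l\<close> modulo \<open>I\<close>. Subtracting \<open>x \<otimes> l\<close>
    therefore turns the multiple of \<open>h\<close> into a cocycle modulo \<open>I\<close>, without
    changing it modulo \<open>I + xR\<close>.\<close>
  define q where "q = (\<lambda>f\<in>carrier (F n). (t \<otimes> s) \<otimes> h f \<ominus> x \<otimes> l f)"
  have q: "q \<in> cochains n" unfolding q_def using h l s t x by (intro cochains_combination) auto
  have "q (d n f) \<in> I" if f: "f \<in> carrier (F (Suc n))" for f
  proof -
    have closed: "h (d n f) \<in> carrier R" "k f \<in> carrier R" "l (d n f) \<in> carrier R"
      using h k l f by simp_all
    have "s \<otimes> h (d n f) \<ominus> x \<otimes> k f \<in> I" using gk[OF f] g_eq[OF f] by simp
    moreover have "t \<otimes> k f \<ominus> l (d n f) \<in> I" using tk[OF f] f by (simp add: cl compose_def)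
    ultimately have "t \<otimes> (s \<otimes> h (d n f) \<ominus> x \<otimes> k f) \<oplus> x \<otimes> (t \<otimes> k f \<ominus> l (d n f)) \<in> I"
      using tR x by (intro I.a_closed I.I_l_closed)
    moreover have "t \<otimes> (s \<otimes> h (d n f) \<ominus> x \<otimes> k f) \<oplus> x \<otimes> (t \<otimes> k f \<ominus> l (d n f)) =
        (t \<otimes> s) \<otimes> h (d n f) \<ominus> x \<otimes> l (d n f)"
      using tR s(1) x closed by algebra
    ultimately show ?thesis using f by (simp add: q_def)
  qed
  from locally_exactD[OF exact(1) q this] obtain u c'
    where u: "u \<in> carrier R - P" and c': "c' \<in> coboundaries n"
      and uq: "\<And>f. f \<in> carrier (F n) \<Longrightarrow> u \<otimes> q f \<ominus> c' f \<in> I" by blast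
  have uR: "u \<in> carrier R" using u by simp
  have "(u \<otimes> (t \<otimes> s)) \<otimes> h f \<ominus> c' f \<in> saturation R P ?J" if f: "f \<in> carrier (F n)" for f
  proof -
    have closed: "h f \<in> carrier R" "l f \<in> carrier R" "c' f \<in> carrier R"
      using h l f coboundaries_cochains[OF c'] by simp_all
    have "u \<otimes> ((t \<otimes> s) \<otimes> h f \<ominus> x \<otimes> l f) \<ominus> c' f \<in> I" using uq[OF f] f by (simp add: q_def)
    moreover have "(u \<otimes> (t \<otimes> s)) \<otimes> h f \<ominus> c' f =
        (u \<otimes> ((t \<otimes> s) \<otimes> h f \<ominus> x \<otimes> l f) \<ominus> c' f) \<oplus> x \<otimes> (u \<otimes> l f)"
      using uR tR s(1) x closed by algebra
    ultimately have "(u \<otimes> (t \<otimes> s)) \<otimes> h f \<ominus> c' f \<in> ?J"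
      using uR closed unfolding adjoin_multiples_def by blast
    then show ?thesis using saturation_superset[OF J P] by blast
  qed
  moreover have "u \<otimes> (t \<otimes> s) \<in> carrier R - P"
  proof -
    have "t \<otimes> s \<notin> P" using t s P.I_prime[of t s] by auto
    then show ?thesis using u t s P.I_prime[of u "t \<otimes> s"] by auto
  qed
  ultimately show "\<exists>s\<in>carrier R - P. \<exists>c\<in>coboundaries n.
      \<forall>f\<in>carrier (F n). s \<otimes> h f \<ominus> c f \<in> saturation R P ?J"
    using c' by blast
qed

text \<open>Otherwise \<open>P\<close> annihilates the class of some \<open>a\<close> outside
  \<open>I\<close>. Sending 1 to \<open>a\<close> maps \<open>R/P\<close> to \<open>R/I\<close>, and
  composing with \<open>h\<close> gives a cocycle of degree 0 modulo \<open>I\<close> that is not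
  zero at \<open>P\<close>, against exactness.\<close>

lemma exists_regular_element:
  assumes P: "primeideal P R" and I: "ideal I R"
    and saturated: "\<And>s a. s \<in> carrier R - P \<Longrightarrow> a \<in> carrier R \<Longrightarrow> s \<otimes> a \<in> I \<Longrightarrow> a \<in> I"
    and exact: "locally_exact P I 0"
    and h: "h \<in> cochains 0" "\<And>f. f \<in> carrier (F 1) \<Longrightarrow> h (d 0 f) \<in> P"
    and f0: "f0 \<in> carrier (F 0)" "h f0 \<notin> P"
  shows "\<exists>x\<in>P. \<forall>a\<in>carrier R. x \<otimes> a \<in> I \<longrightarrow> a \<in> I"
proof (rule ccontr)
  interpret P: primeideal P R by fact
  interpret I: ideal I R by fact
  assume "\<not> ?thesis"
  then have "\<exists>a\<in>carrier R - I. x \<otimes> a \<in> I" if "x \<in> P" for x using that by blast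
  from exists_common_annihilated_element[OF I P.is_ideal this]
  obtain a where a: "a \<in> carrier R" "a \<notin> I" "\<And>x. x \<in> P \<Longrightarrow> x \<otimes> a \<in> I" by auto
  let ?k = "\<lambda>f\<in>carrier (F 0). a \<otimes> h f"
  have k: "?k \<in> cochains 0" using cochains_smult[OF h(1) a(1)] .
  have "?k (d 0 f) \<in> I" if f: "f \<in> carrier (F (Suc 0))" for f
    using a(3)[OF h(2)[of f]] f a(1) h(1) by (simp add: m_comm)
  from locally_exactD[OF exact k this] obtain s c where s: "s \<in> carrier R - P"
    and c: "c \<in> coboundaries 0" and sk: "\<And>f. f \<in> carrier (F 0) \<Longrightarrow> s \<otimes> ?k f \<ominus> c f \<in> I"
    by blast
  have hf: "h f0 \<in> carrier R" using h(1) f0(1) by simp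
  \<comment> \<open>The zero map is the only coboundary in degree 0, so \<open>c f0\<close> is
    \<open>\<zero>\<close>.\<close>
  have "s \<otimes> (a \<otimes> h f0) \<ominus> \<zero> \<in> I"
    using sk[OF f0(1)] c f0(1) by (simp add: hom_coboundaries_def)
  moreover have "s \<otimes> (a \<otimes> h f0) \<ominus> \<zero> = (s \<otimes> h f0) \<otimes> a"
    using s a(1) hf by (simp add: minus_eq m_ac)
  moreover have "s \<otimes> h f0 \<in> carrier R - P" using s hf f0(2) P.I_prime[of s "h f0"] by auto
  ultimately show False using saturated a by metis
qed

text \<open>Induction on the number of exact degrees. A regular \<open>x\<close> leads from
  \<open>I\<close> to the saturation of \<open>I + xR\<close>; the chain over the new ideal starts
  at a prime containing \<open>x\<close>, which is not minimal over \<open>I\<close>, so the chain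
  extends downwards by one. Saturating preserves the cancellation hypothesis.\<close>

lemma exists_prime_chain:
  assumes P: "primeideal P R"
    and h: "h \<in> cochains 0" "\<And>f. f \<in> carrier (F 1) \<Longrightarrow> h (d 0 f) \<in> P"
    and f0: "f0 \<in> carrier (F 0)" "h f0 \<notin> P"
    and "ideal I R" "I \<subseteq> P"
    and "\<And>s a. s \<in> carrier R - P \<Longrightarrow> a \<in> carrier R \<Longrightarrow> s \<otimes> a \<in> I \<Longrightarrow> a \<in> I"
    and "\<And>i. i < n \<Longrightarrow> locally_exact P I i"
  shows "\<exists>Q :: nat \<Rightarrow> 'a set. (\<forall>i\<le>n. primeideal (Q i) R \<and> I \<subseteq> Q i) \<and> (\<forall>i<n. Q i \<subset> Q (Suc i)) \<and> Q n = P"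
  using assms(6-9)
proof (induction n arbitrary: I)
  case 0
  then show ?case using P by (intro exI[of _ "\<lambda>_. P"]) simp
next
  case (Suc n)
  interpret P: primeideal P R by fact
  have "\<exists>x\<in>P. \<forall>a\<in>carrier R. x \<otimes> a \<in> I \<longrightarrow> a \<in> I"
    using Suc.prems by (intro exists_regular_element[OF P Suc.prems(1) _ _ h f0]) auto
  then obtain x where x: "x \<in> P" and regular: "\<And>a. a \<in> carrier R \<Longrightarrow> x \<otimes> a \<in> I \<Longrightarrow> a \<in> I" by blast
  have xR: "x \<in> carrier R" using x by (rule P.Icarr)
  let ?J = "adjoin_multiples R I x"
  let ?I = "saturation R P ?J"
  have J: "ideal ?J R" by (rule adjoin_multiples_ideal[OF Suc.prems(1) xR])
  have JP: "?J \<subseteq> P" using Suc.prems(2) x xR by (auto simp: adjoin_multiples_def P.I_r_closed)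
  have JI: "?J \<subseteq> ?I" by (rule saturation_superset[OF J P])
  have "i \<in> ?J" if "i \<in> I" for i
    unfolding adjoin_multiples_def using that xR ideal.Icarr[OF Suc.prems(1)]
    by (intro CollectI exI[of _ i] exI[of _ \<zero>]) auto
  then have II: "I \<subseteq> ?I" using JI by blast
  have "x \<in> ?J"
    unfolding adjoin_multiples_def using xR additive_subgroup.zero_closed[OF ideal.axioms(1)[OF Suc.prems(1)]]
    by (intro CollectI exI[of _ \<zero>] exI[of _ \<one>]) auto
  then have xI: "x \<in> ?I" using JI by blast
  have "\<exists>Q :: nat \<Rightarrow> 'a set. (\<forall>i\<le>n. primeideal (Q i) R \<and> ?I \<subseteq> Q i) \<and> (\<forall>i<n. Q i \<subset> Q (Suc i)) \<and> Q n = P"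
  proof (rule Suc.IH)
    show "ideal ?I R" by (rule saturation_ideal[OF J P])
    show "?I \<subseteq> P" by (rule saturation_subset[OF P JP])
    show "a \<in> ?I" if "s \<in> carrier R - P" "a \<in> carrier R" "s \<otimes> a \<in> ?I" for s a
      by (rule saturation_saturated[OF P that])
    \<comment> \<open>Degree \<open>i\<close> for the new ideal uses degrees \<open>i\<close> and
      \<open>Suc i\<close> for the old one; hence the bound drops from \<open>Suc n\<close> to
      \<open>n\<close>.\<close>
    show "locally_exact P ?I i" if "i < n" for i
      using locally_exact_quotient[OF P Suc.prems(1) xR regular] Suc.prems(4) that by simp
  qed
  then obtain Q where Q: "\<And>i. i \<le> n \<Longrightarrow> primeideal (Q i) R \<and> ?I \<subseteq> Q i"
    "\<And>i. i < n \<Longrightarrow> Q i \<subset> Q (Suc i)" "Q n = P" by blast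
  have "\<exists>Q'. primeideal Q' R \<and> I \<subseteq> Q' \<and> Q' \<subset> Q 0"
    using Q(1)[of 0] II xI regular by (intro exists_smaller_prime[OF Suc.prems(1), of "Q 0" x]) auto
  then obtain Q' where Q': "primeideal Q' R" "I \<subseteq> Q'" "Q' \<subset> Q 0" by blast
  have "primeideal (case_nat Q' Q i) R \<and> I \<subseteq> case_nat Q' Q i" if "i \<le> Suc n" for i
    using that Q' Q(1) II by (cases i) auto
  moreover have "case_nat Q' Q i \<subset> case_nat Q' Q (Suc i)" if "i < Suc n" for i
    using that Q' Q(2) by (cases i) auto
  ultimately show ?case using Q(3) by (intro exI[of _ "case_nat Q' Q"]) simp
qed

end

subsection \<open>Maps to residue domains\<close>

context module
begin

lemma adjoin_element_submodule:
  assumes "submodule N R M" "m \<in> carrier M"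
  shows "submodule {n \<oplus>\<^bsub>M\<^esub> c \<odot>\<^bsub>M\<^esub> m | n c. n \<in> N \<and> c \<in> carrier R} R M" (is "submodule ?K R M")
proof (rule submoduleI)
  note N = submoduleE[OF assms(1)]
  have NM: "n \<in> carrier M" if "n \<in> N" for n using that N(1) by blast
  show "?K \<subseteq> carrier M" using NM assms(2) by auto
  show "\<zero>\<^bsub>M\<^esub> \<in> ?K"
    using submodule_zero_closed[OF assms(1)] assms(2)
    by (intro CollectI exI[of _ "\<zero>\<^bsub>M\<^esub>"] exI[of _ "\<zero>\<^bsub>R\<^esub>"]) auto
  fix a assume "a \<in> ?K"
  then obtain n c where a: "n \<in> N" "c \<in> carrier R" "a = n \<oplus>\<^bsub>M\<^esub> c \<odot>\<^bsub>M\<^esub> m" by blast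
  have "\<ominus>\<^bsub>M\<^esub> a = \<ominus>\<^bsub>M\<^esub> n \<oplus>\<^bsub>M\<^esub> (\<ominus>\<^bsub>R\<^esub> c) \<odot>\<^bsub>M\<^esub> m"
    using a assms(2) NM by (simp add: M.minus_add smult_l_minus)
  then show "\<ominus>\<^bsub>M\<^esub> a \<in> ?K" using a N(3) R.a_inv_closed by blast
  {
    fix b assume "b \<in> ?K"
    then obtain n' c' where b: "n' \<in> N" "c' \<in> carrier R" "b = n' \<oplus>\<^bsub>M\<^esub> c' \<odot>\<^bsub>M\<^esub> m" by blast
    have "a \<oplus>\<^bsub>M\<^esub> b = (n \<oplus>\<^bsub>M\<^esub> n') \<oplus>\<^bsub>M\<^esub> (c \<oplus>\<^bsub>R\<^esub> c') \<odot>\<^bsub>M\<^esub> m"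
      using a b assms(2) NM by (simp add: smult_l_distr M.a_ac)
    then show "a \<oplus>\<^bsub>M\<^esub> b \<in> ?K" using a b N(5) R.a_closed by blast
  next
    fix r assume r: "r \<in> carrier R"
    have "r \<odot>\<^bsub>M\<^esub> a = r \<odot>\<^bsub>M\<^esub> n \<oplus>\<^bsub>M\<^esub> (r \<otimes>\<^bsub>R\<^esub> c) \<odot>\<^bsub>M\<^esub> m"
      using a r assms(2) NM by (simp add: smult_r_distr smult_assoc1)
    then show "r \<odot>\<^bsub>M\<^esub> a \<in> ?K" using a r N(4) R.m_closed by blast
  }
qed

text \<open>Generators are adjoined to \<open>N\<close> as long as the quotient stays nonzero at
  \<open>P\<close>. At the last stage before it vanishes there, the next generator \<open>m\<close>
  generates the quotient locally: a single \<open>s\<close> takes all of \<open>M\<close> into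
  \<open>N' + Rm\<close>.\<close>

lemma exists_locally_cyclic_quotient:
  assumes "finite A" "A \<subseteq> carrier M" "primeideal P R" "submodule N R M"
    and "\<And>s. s \<in> carrier R - P \<Longrightarrow> \<exists>y\<in>carrier M. s \<odot>\<^bsub>M\<^esub> y \<notin> N"
    and "\<And>K. submodule K R M \<Longrightarrow> N \<subseteq> K \<Longrightarrow> A \<subseteq> K \<Longrightarrow> K = carrier M"
  shows "\<exists>N' m s. submodule N' R M \<and> m \<in> carrier M \<and> s \<in> carrier R - P \<and>
    (\<forall>s\<in>carrier R - P. \<exists>y\<in>carrier M. s \<odot>\<^bsub>M\<^esub> y \<notin> N') \<and>
    (\<forall>y\<in>carrier M. \<exists>n\<in>N'. \<exists>c\<in>carrier R. s \<odot>\<^bsub>M\<^esub> y = n \<oplus>\<^bsub>M\<^esub> c \<odot>\<^bsub>M\<^esub> m)"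
  using assms(1,2,4-6)
proof (induction A arbitrary: N)
  case empty
  have "\<one>\<^bsub>R\<^esub> \<in> carrier R - P"
    using primeideal.I_notcarr[OF assms(3)] ideal.one_imp_carrier[OF primeideal.axioms(1)[OF assms(3)]]
    by auto
  \<comment> \<open>With no generators left \<open>N\<close> is everything, which contradicts
    nonvanishing at the multiplier 1.\<close>
  moreover have "N = carrier M" by (rule empty.prems(4)) (use empty.prems in auto)
  ultimately show ?case using empty.prems(3)[of "\<one>\<^bsub>R\<^esub>"] by auto
next
  case (insert a A)
  let ?K = "{n \<oplus>\<^bsub>M\<^esub> c \<odot>\<^bsub>M\<^esub> a | n c. n \<in> N \<and> c \<in> carrier R}"
  have a: "a \<in> carrier M" using insert.prems(1) by simp
  have K: "submodule ?K R M" by (rule adjoin_element_submodule[OF insert.prems(2) a])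
  show ?case
  proof (cases "\<exists>s\<in>carrier R - P. \<forall>y\<in>carrier M. s \<odot>\<^bsub>M\<^esub> y \<in> ?K")
    case True
    then obtain s where "s \<in> carrier R - P" "\<forall>y\<in>carrier M. s \<odot>\<^bsub>M\<^esub> y \<in> ?K" by blast
    then show ?thesis
      using insert.prems(2,3) a by (intro exI[of _ N] exI[of _ a] exI[of _ s]) blast
  next
    case False
    have NK: "n \<in> ?K" if "n \<in> N" for n
      using that a submoduleE(1)[OF insert.prems(2)]
      by (intro CollectI exI[of _ n] exI[of _ "\<zero>\<^bsub>R\<^esub>"]) auto
    have aK: "a \<in> ?K"
      using a submodule_zero_closed[OF insert.prems(2)]
      by (intro CollectI exI[of _ "\<zero>\<^bsub>M\<^esub>"] exI[of _ "\<one>\<^bsub>R\<^esub>"]) auto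
    show ?thesis
    proof (rule insert.IH[OF _ K])
      show "A \<subseteq> carrier M" using insert.prems(1) by simp
      show "\<exists>y\<in>carrier M. s \<odot>\<^bsub>M\<^esub> y \<notin> ?K" if "s \<in> carrier R - P" for s
        using False that by blast
      show "L = carrier M" if L: "submodule L R M" "?K \<subseteq> L" "A \<subseteq> L" for L
      proof (rule insert.prems(4)[OF L(1)])
        show "N \<subseteq> L" using NK L(2) by blast
        show "insert a A \<subseteq> L" using aK L(2,3) by blast
      qed
    qed
  qed
qed

lemma submodule_finsum_closed:
  assumes "submodule K R M" "finite A" "f \<in> A \<rightarrow> K"
  shows "finsum M f A \<in> K"
  using assms(2,3)
proof (induction A)
  case empty
  then show ?case using submodule_zero_closed[OF assms(1)] by simp
next
  case (insert a A)
  have "finsum M f (insert a A) = f a \<oplus>\<^bsub>M\<^esub> finsum M f A"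
    using insert submoduleE(1)[OF assms(1)] by (intro M.finsum_insert) auto
  then show ?case using insert submoduleE(5)[OF assms(1)] by auto
qed

text \<open>A finitely generated module has a nonzero cyclic quotient locally at each prime \<open>P\<close> of its
  support, hence a map to \<open>R/P\<close> that does not vanish; \<open>h\<close> is a lift of such a map to \<open>R\<close>.\<close>

lemma exists_nonzero_map_mod_prime:
  assumes fg: "fin_gen_module R M" and supp: "P \<in> Supp R M"
    and e: "e \<in> linear_maps R (free_module R B) M" "e ` carrier (free_module R B) = carrier M"
  shows "\<exists>h\<in>linear_maps R (free_module R B) (ring_module R).
    (\<forall>f\<in>a_kernel (free_module R B) M e. h f \<in> P) \<and> (\<exists>f\<in>carrier (free_module R B). h f \<notin> P)"
proof -
  let ?F = "free_module R B"
  interpret F: module R ?F by (rule free_module_module)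
  have P: "primeideal P R" using supp by (simp add: Supp_iff[OF module_axioms])
  interpret P: primeideal P R by (rule P)
  obtain x where x: "x \<in> carrier M" "\<And>s. s \<in> carrier R - P \<Longrightarrow> s \<odot>\<^bsub>M\<^esub> x \<noteq> \<zero>\<^bsub>M\<^esub>"
    using supp by (auto simp: Supp_iff[OF module_axioms])
  obtain A where A: "finite A" "A \<subseteq> carrier M"
    "carrier M = {\<Oplus>\<^bsub>M\<^esub>a\<in>A. c a \<odot>\<^bsub>M\<^esub> a | c. c \<in> A \<rightarrow> carrier R}"
    using fg unfolding fin_gen_module_def by blast
  have "\<exists>N m s. submodule N R M \<and> m \<in> carrier M \<and> s \<in> carrier R - P \<and>
    (\<forall>s\<in>carrier R - P. \<exists>y\<in>carrier M. s \<odot>\<^bsub>M\<^esub> y \<notin> N) \<and>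
    (\<forall>y\<in>carrier M. \<exists>n\<in>N. \<exists>c\<in>carrier R. s \<odot>\<^bsub>M\<^esub> y = n \<oplus>\<^bsub>M\<^esub> c \<odot>\<^bsub>M\<^esub> m)"
  proof (rule exists_locally_cyclic_quotient[OF A(1,2) P])
    show "submodule {\<zero>\<^bsub>M\<^esub>} R M" by (intro submoduleI) auto
    show "\<exists>y\<in>carrier M. s \<odot>\<^bsub>M\<^esub> y \<notin> {\<zero>\<^bsub>M\<^esub>}" if "s \<in> carrier R - P" for s
      using x that by auto
    show "K = carrier M" if K: "submodule K R M" "A \<subseteq> K" for K
    proof
      show "carrier M \<subseteq> K"
      proof
        fix y assume "y \<in> carrier M"
        then obtain c where c: "c \<in> A \<rightarrow> carrier R" "y = (\<Oplus>\<^bsub>M\<^esub>a\<in>A. c a \<odot>\<^bsub>M\<^esub> a)" using A(3) by blast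
        show "y \<in> K"
          unfolding c(2) using c(1) K(2) submoduleE(4)[OF K(1)]
          by (intro submodule_finsum_closed[OF K(1) A(1)]) blast
      qed
    qed (rule submoduleE(1)[OF K(1)])
  qed
  then obtain N m s where N: "submodule N R M" and m: "m \<in> carrier M" and s: "s \<in> carrier R" "s \<notin> P"
    and not_loc: "\<And>s. s \<in> carrier R - P \<Longrightarrow> \<exists>y\<in>carrier M. s \<odot>\<^bsub>M\<^esub> y \<notin> N"
    and cyc: "\<And>y. y \<in> carrier M \<Longrightarrow> \<exists>n\<in>N. \<exists>c\<in>carrier R. s \<odot>\<^bsub>M\<^esub> y = n \<oplus>\<^bsub>M\<^esub> c \<odot>\<^bsub>M\<^esub> m"
    by blast
  note Nc = submoduleE[OF N]
  have NM: "n \<in> carrier M" if "n \<in> N" for n using that Nc(1) by blast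
  \<comment> \<open>The annihilator of the class of \<open>m\<close> modulo \<open>N\<close> lies in
    \<open>P\<close>, since otherwise the product of \<open>r\<close> and \<open>s\<close> would
    take all of \<open>M\<close> into \<open>N\<close>. So sending \<open>m\<close> to 1 is well
    defined modulo \<open>P\<close>.\<close>
  have multiplier: "r \<in> P" if r: "r \<in> carrier R" "r \<odot>\<^bsub>M\<^esub> m \<in> N" for r
  proof (rule ccontr)
    assume "r \<notin> P"
    then have "r \<otimes>\<^bsub>R\<^esub> s \<in> carrier R - P" using r s P.I_prime[of r s] by auto
    then obtain y where y: "y \<in> carrier M" "(r \<otimes>\<^bsub>R\<^esub> s) \<odot>\<^bsub>M\<^esub> y \<notin> N" using not_loc by blast
    obtain n c where nc: "n \<in> N" "c \<in> carrier R" "s \<odot>\<^bsub>M\<^esub> y = n \<oplus>\<^bsub>M\<^esub> c \<odot>\<^bsub>M\<^esub> m" using cyc[OF y(1)] by blast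
    have "(r \<otimes>\<^bsub>R\<^esub> s) \<odot>\<^bsub>M\<^esub> y = r \<odot>\<^bsub>M\<^esub> (n \<oplus>\<^bsub>M\<^esub> c \<odot>\<^bsub>M\<^esub> m)" using nc(3) r s y by (simp add: smult_assoc1)
    also have "\<dots> = r \<odot>\<^bsub>M\<^esub> n \<oplus>\<^bsub>M\<^esub> (r \<otimes>\<^bsub>R\<^esub> c) \<odot>\<^bsub>M\<^esub> m"
      using nc r m NM by (simp add: smult_r_distr smult_assoc1)
    also have "(r \<otimes>\<^bsub>R\<^esub> c) \<odot>\<^bsub>M\<^esub> m = c \<odot>\<^bsub>M\<^esub> (r \<odot>\<^bsub>M\<^esub> m)"
      using nc r m R.m_comm[of r c] by (simp add: smult_assoc1)
    finally show False using y(2) nc r Nc(4,5) by simp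
  qed
  \<comment> \<open>The coefficient of \<open>m\<close> in \<open>s\<close> times the image of a
    basis vector. Its linear extension \<open>h\<close> lifts \<open>s\<close> times the map that
    sends \<open>m\<close> to 1.\<close>
  have "\<exists>c\<in>carrier R. s \<odot>\<^bsub>M\<^esub> e (unit_vector R b) \<oplus>\<^bsub>M\<^esub> \<ominus>\<^bsub>M\<^esub> (c \<odot>\<^bsub>M\<^esub> m) \<in> N" if b: "b \<in> B" for b
  proof -
    obtain n c where nc: "n \<in> N" "c \<in> carrier R" "s \<odot>\<^bsub>M\<^esub> e (unit_vector R b) = n \<oplus>\<^bsub>M\<^esub> c \<odot>\<^bsub>M\<^esub> m"
      using cyc[of "e (unit_vector R b)"] e(1) unit_vector_closed[OF b] by auto
    then have "s \<odot>\<^bsub>M\<^esub> e (unit_vector R b) \<oplus>\<^bsub>M\<^esub> \<ominus>\<^bsub>M\<^esub> (c \<odot>\<^bsub>M\<^esub> m) = n"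
      using m NM by (simp add: M.a_assoc M.r_neg)
    then show ?thesis using nc(1,2) by (intro bexI[of _ c]) simp_all
  qed
  then obtain c where c: "\<And>b. b \<in> B \<Longrightarrow> c b \<in> carrier R"
    "\<And>b. b \<in> B \<Longrightarrow> s \<odot>\<^bsub>M\<^esub> e (unit_vector R b) \<oplus>\<^bsub>M\<^esub> \<ominus>\<^bsub>M\<^esub> (c b \<odot>\<^bsub>M\<^esub> m) \<in> N" by metis
  have "c \<in> B \<rightarrow> carrier (ring_module R)" using c by auto
  from free_module_linear_extension[OF ring_module_module this]
  obtain h where h: "h \<in> linear_maps R ?F (ring_module R)"
    and hb: "\<And>b. b \<in> B \<Longrightarrow> h (unit_vector R b) = c b" by blast
  have hR: "h f \<in> carrier R" if "f \<in> carrier ?F" for f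
    using linear_maps_closed[OF h that] by simp
  have eM: "e f \<in> carrier M" if "f \<in> carrier ?F" for f
    by (rule linear_maps_closed[OF e(1) that])
  \<comment> \<open>The defect in the congruence of \<open>s e\<close> and \<open>h m\<close> modulo
    \<open>N\<close>; as it is linear, the basis controls it.\<close>
  define g where "g = (\<lambda>f\<in>carrier ?F. s \<odot>\<^bsub>M\<^esub> e f \<oplus>\<^bsub>M\<^esub> \<ominus>\<^bsub>M\<^esub> (h f \<odot>\<^bsub>M\<^esub> m))"
  have g: "g \<in> linear_maps R ?F M"
  proof (rule linear_mapsI)
    fix f f' assume ff: "f \<in> carrier ?F" "f' \<in> carrier ?F"
    have "h (f \<oplus>\<^bsub>?F\<^esub> f') = h f \<oplus>\<^bsub>R\<^esub> h f'" using linear_maps_add[OF h ff] by simp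
    then show "g (f \<oplus>\<^bsub>?F\<^esub> f') = g f \<oplus>\<^bsub>M\<^esub> g f'"
      using ff F.a_closed[OF ff] linear_maps_add[OF e(1) ff] hR eM s m
      by (simp add: g_def smult_l_distr smult_r_distr M.minus_add M.a_ac del: free_module_simps)
  next
    fix r f assume rf: "r \<in> carrier R" "f \<in> carrier ?F"
    have "h (r \<odot>\<^bsub>?F\<^esub> f) = r \<otimes>\<^bsub>R\<^esub> h f" using linear_maps_smult[OF h rf] by simp
    moreover have "s \<odot>\<^bsub>M\<^esub> (r \<odot>\<^bsub>M\<^esub> e f) = r \<odot>\<^bsub>M\<^esub> (s \<odot>\<^bsub>M\<^esub> e f)"
      using rf s eM R.m_comm[of s r] by (simp add: smult_assoc1[symmetric])
    ultimately show "g (r \<odot>\<^bsub>?F\<^esub> f) = r \<odot>\<^bsub>M\<^esub> g f"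
      using rf F.smult_closed[OF rf] linear_maps_smult[OF e(1) rf] hR eM s m
      by (simp add: g_def smult_r_distr smult_r_minus smult_assoc1 del: free_module_simps)
  qed (use hR eM s m in \<open>auto simp: g_def\<close>)
  have "carrier ?F \<subseteq> {f \<in> carrier ?F. g f \<in> N}"
    using c(2) hb
    by (intro free_module_subset_submodule linear_preimage_submodule[OF F.module_axioms module_axioms g N])
      (auto simp: g_def unit_vector_closed)
  then have gN: "s \<odot>\<^bsub>M\<^esub> e f \<oplus>\<^bsub>M\<^esub> \<ominus>\<^bsub>M\<^esub> (h f \<odot>\<^bsub>M\<^esub> m) \<in> N" if "f \<in> carrier ?F" for f
    using that by (auto simp: g_def subset_iff)
  have "m \<in> e ` carrier ?F" using m e(2) by simp
  then obtain f where f: "f \<in> carrier ?F" "e f = m" by blast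
  have "h f \<in> P" if "f \<in> a_kernel ?F M e" for f
  proof -
    have f: "f \<in> carrier ?F" "e f = \<zero>\<^bsub>M\<^esub>" using that by (simp_all add: a_kernel_iff)
    then have "\<ominus>\<^bsub>M\<^esub> (h f \<odot>\<^bsub>M\<^esub> m) \<in> N" using gN[OF f(1)] s m hR by simp
    then have "h f \<odot>\<^bsub>M\<^esub> m \<in> N" using Nc(3) m hR[OF f(1)] by fastforce
    then show ?thesis using multiplier hR f(1) by blast
  qed
  \<comment> \<open>Over \<open>m\<close> the value of \<open>h\<close> is congruent to
    \<open>s\<close> modulo \<open>P\<close>, and \<open>s\<close> is outside
    \<open>P\<close>.\<close>
  moreover have "h f \<notin> P"
  proof
    assume "h f \<in> P"
    have "(s \<oplus>\<^bsub>R\<^esub> \<ominus>\<^bsub>R\<^esub> h f) \<odot>\<^bsub>M\<^esub> m \<in> N"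
      using gN[OF f(1)] f(2) s m hR[OF f(1)] by (simp add: smult_l_distr smult_l_minus)
    moreover have "s \<oplus>\<^bsub>R\<^esub> \<ominus>\<^bsub>R\<^esub> h f \<in> carrier R" using s(1) hR[OF f(1)] by simp
    ultimately have "s \<oplus>\<^bsub>R\<^esub> \<ominus>\<^bsub>R\<^esub> h f \<in> P" by (intro multiplier)
    then have "(s \<oplus>\<^bsub>R\<^esub> \<ominus>\<^bsub>R\<^esub> h f) \<oplus>\<^bsub>R\<^esub> h f \<in> P" using \<open>h f \<in> P\<close> by (rule P.a_closed)
    then show False using s hR[OF f(1)] by (simp add: R.a_assoc R.l_neg)
  qed
  ultimately show ?thesis using h f(1) by blast
qed

end

subsection \<open>The dimension of Ext\<close>

lemma krull_dim_ge_chain: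
  assumes "\<And>i. i \<le> n \<Longrightarrow> P i \<in> X" "\<And>i. i < n \<Longrightarrow> P i \<subset> P (Suc i)"
  shows "ereal (real n) \<le> krull_dim X"
  unfolding krull_dim_def by (rule Sup_upper) (use assms in blast)

text \<open>A finite supremum of natural numbers is attained: some chain is longer than
  \<open>r - 1\<close>, so it has at least \<open>r\<close> steps and can be cut off after
  \<open>r\<close> of them.\<close>

lemma krull_dim_eq_chain:
  assumes "krull_dim X = ereal (real r)"
  shows "\<exists>P :: nat \<Rightarrow> 'a set. (\<forall>i\<le>r. P i \<in> X) \<and> (\<forall>i<r. P i \<subset> P (Suc i))"
proof -
  have "ereal (real r - 1) < krull_dim X" using assms by simp
  then obtain n and P :: "nat \<Rightarrow> 'a set" where "real r - 1 < real n"
    and P: "\<forall>i\<le>n. P i \<in> X" "\<forall>i<n. P i \<subset> P (Suc i)"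
    unfolding krull_dim_def less_Sup_iff by auto
  then have "r \<le> n" by linarith
  then show ?thesis using P by (intro exI[of _ P]) simp
qed

text \<open>The choice hidden in \<open>Ext\<close> does not involve the degree, so one resolution
  computes all degrees at once; the connecting argument relates neighbouring degrees of the same
  complex.\<close>

lemma Ext_from_resolution:
  fixes R :: "('a, 'x) ring_scheme" and M :: "('a, 'm, 'y) module_scheme"
    and N :: "('a, 'n, 'z) module_scheme"
  assumes "module R M"
  obtains B d e where "free_resolution R M B d e"
    "\<And>j. Ext R M N (int j) = hom_cohomology R (\<lambda>n. free_module R (B n)) d N j"
proof -
  define BD :: "(nat \<Rightarrow> ('a + 'm) list set) \<times> (nat \<Rightarrow> (('a + 'm) list \<Rightarrow> 'a) \<Rightarrow> ('a + 'm) list \<Rightarrow> 'a)"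
    where "BD = (SOME (B, d). \<exists>e. free_resolution R M B d e)"
  have "\<exists>BD :: (nat \<Rightarrow> ('a + 'm) list set) \<times> (nat \<Rightarrow> (('a + 'm) list \<Rightarrow> 'a) \<Rightarrow> ('a + 'm) list \<Rightarrow> 'a).
      case BD of (B, d) \<Rightarrow> \<exists>e. free_resolution R M B d e"
    using exists_free_resolution[OF assms] by simp
  then have "case BD of (B, d) \<Rightarrow> \<exists>e. free_resolution R M B d e"
    unfolding BD_def by (rule someI_ex)
  then obtain B d e where BD: "BD = (B, d)" "free_resolution R M B d e" by (cases BD) auto
  have "Ext R M N (int j) = hom_cohomology R (\<lambda>n. free_module R (B n)) d N j" for j
    unfolding Ext_def BD_def[symmetric] BD(1) by simp
  then show thesis using that BD(2) by blast
qed

theorem corollary1p2: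
  fixes R :: "('a, 'x) ring_scheme"
    and M :: "('a, 'm, 'y) module_scheme"
    and d r g :: nat
  assumes "local_ring R"
    and "noetherian_ring R"
    and "ring_dim R = ereal (real d)"
    and "module R M"
    and "fin_gen_module R M"
    and "module_dim R M = ereal (real r)"
    and "grade R M = ereal (real g)"
    and "\<forall>i::int. module_dim R (Ext R M (ring_module R) (int d - i)) \<le> ereal (real_of_int i)"
    and "int g = int d - int r"
  shows "module_dim R (Ext R M (ring_module R) (int d - int r)) = ereal (real r)"
proof (rule antisym)
  show "module_dim R (Ext R M (ring_module R) (int d - int r)) \<le> ereal (real r)"
    using assms(8)[rule_format, of "int r"] by simp
next
  interpret M: module R M by fact
  interpret N: noetherian_ring R by fact
  interpret noetherian_cring R ..
  obtain B \<delta> e where res: "free_resolution R M B \<delta> e"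
    and Ext: "\<And>j. Ext R M (ring_module R) (int j) =
      hom_cohomology R (\<lambda>n. free_module R (B n)) \<delta> (ring_module R) j"
    by (rule Ext_from_resolution[OF assms(4), of "ring_module R"]) blast
  note res' = res[unfolded free_resolution_def Let_def]
  interpret noetherian_free_complex R B \<delta>
  proof
    show "\<delta> n \<in> linear_maps R (free_module R (B (Suc n))) (free_module R (B n))" for n
      using res' by blast
    fix f n assume "f \<in> carrier (free_module R (B (Suc (Suc n))))"
    then have "\<delta> (Suc n) f \<in> a_kernel (free_module R (B (Suc n))) (free_module R (B n)) (\<delta> n)"
      using res' by blast
    then show "\<delta> n (\<delta> (Suc n) f) = (\<lambda>_. \<zero>\<^bsub>R\<^esub>)" by (simp add: a_kernel_iff)
  qed
  define E where "E = Ext R M (ring_module R) (int g)"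
  have E_module: "module R E" unfolding E_def Ext by (rule cohomology_module)
  obtain P :: "nat \<Rightarrow> 'a set" where P: "\<And>i. i \<le> r \<Longrightarrow> P i \<in> Supp R M"
    "\<And>i. i < r \<Longrightarrow> P i \<subset> P (Suc i)"
    using krull_dim_eq_chain[of "Supp R M" r] assms(6) unfolding module_dim_def by blast
  have prime: "primeideal (P i) R" if "i \<le> r" for i
    using P(1)[OF that] by (simp add: Supp_iff[OF assms(4)])
  have "P 0 \<in> Supp R E"
  proof (rule ccontr)
    assume "P 0 \<notin> Supp R E"
    then have tors_g: "\<exists>s\<in>carrier R - P 0. s \<odot>\<^bsub>E\<^esub> X = \<zero>\<^bsub>E\<^esub>" if "X \<in> carrier E" for X
      using that prime[of 0] by (auto simp: Supp_iff[OF E_module])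
    let ?I = "saturation R (P 0) {\<zero>\<^bsub>R\<^esub>}"
    interpret P0: primeideal "P 0" R by (rule prime) simp
    have exact: "locally_exact (P 0) ?I j" if "j < Suc g" for j
    proof (rule locally_exact_zero[OF P0.primeideal])
      let ?H = "hom_cohomology R F \<delta> (ring_module R) j"
      interpret H: module R ?H by (rule cohomology_module)
      \<comment> \<open>Degree \<open>g\<close> is torsion by the assumption on \<open>P 0\<close>;
        in lower degrees the cohomology is zero by the definition of the grade.\<close>
      have "\<exists>s\<in>carrier R - P 0. s \<odot>\<^bsub>?H\<^esub> X = \<zero>\<^bsub>?H\<^esub>" if X: "X \<in> carrier ?H" for X
      proof (cases "j = g")
        case True
        then show ?thesis using tors_g X by (simp add: E_def Ext)
      next
        case False
        have "is_zero_module ?H"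
        proof (rule ccontr)
          assume "\<not> is_zero_module ?H"
          then have "\<not> is_zero_module (Ext R M (ring_module R) (int j))" by (simp add: Ext)
          then have "grade R M \<le> ereal (real_of_int (int j))"
            unfolding grade_def by (intro Inf_lower) blast
          then show False using assms(7) False \<open>j < Suc g\<close> by simp
        qed
        moreover have "\<one>\<^bsub>R\<^esub> \<in> carrier R - P 0" using P0.I_notcarr P0.one_imp_carrier by auto
        ultimately show ?thesis using X by (intro bexI[of _ "\<one>\<^bsub>R\<^esub>"]) (auto simp: is_zero_module_def)
      qed
      then show "\<exists>s\<in>carrier R - P 0. (\<lambda>f\<in>carrier (F j). s \<otimes>\<^bsub>R\<^esub> h f) \<in> coboundaries j"
        if "h \<in> cocycles j" for h
        using that by (intro multiple_coboundary) auto
    qed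
    have "e \<in> linear_maps R (F 0) M" "e ` carrier (F 0) = carrier M" using res' by auto
    from M.exists_nonzero_map_mod_prime[OF assms(5) P(1)[of 0] this]
    obtain h f0 where h: "h \<in> cochains 0" "\<And>f. f \<in> a_kernel (F 0) M e \<Longrightarrow> h f \<in> P 0"
      and f0: "f0 \<in> carrier (F 0)" "h f0 \<notin> P 0" by auto
    \<comment> \<open>The image of \<open>\<delta> 0\<close> is the kernel of \<open>e\<close>,
      where \<open>h\<close> takes values in \<open>P 0\<close>.\<close>
    have h\<delta>: "h (\<delta> 0 f) \<in> P 0" if "f \<in> carrier (F 1)" for f
      using h(2) res' that by blast
    have "\<exists>Q :: nat \<Rightarrow> 'a set. (\<forall>i\<le>Suc g. primeideal (Q i) R \<and> ?I \<subseteq> Q i) \<and>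
        (\<forall>i<Suc g. Q i \<subset> Q (Suc i)) \<and> Q (Suc g) = P 0"
    proof (rule exists_prime_chain[OF P0.primeideal h(1) h\<delta> f0])
      show "ideal ?I R" by (rule M.saturation_ideal[OF M.zeroideal P0.primeideal])
      show "?I \<subseteq> P 0" by (rule M.saturation_subset[OF P0.primeideal]) simp
      show "a \<in> ?I" if "s \<in> carrier R - P 0" "a \<in> carrier R" "s \<otimes>\<^bsub>R\<^esub> a \<in> ?I" for s a
        by (rule M.saturation_saturated[OF P0.primeideal that])
    qed (use exact in auto)
    then obtain Q where Q: "\<And>i. i \<le> Suc g \<Longrightarrow> primeideal (Q i) R"
      "\<And>i. i < Suc g \<Longrightarrow> Q i \<subset> Q (Suc i)" "Q (Suc g) = P 0" by blast
    \<comment> \<open>\<open>Q\<close> has \<open>Suc g\<close> steps and ends where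
      \<open>P\<close> starts, hence the index shift. Glued together they have
      \<open>Suc g + r = d + 1\<close> steps, one more than \<open>ring_dim R\<close>
      allows.\<close>
    define C where "C i = (if i \<le> Suc g then Q i else P (i - Suc g))" for i
    have "ereal (real (Suc g + r)) \<le> krull_dim (Spec R)"
    proof (rule krull_dim_ge_chain)
      show "C i \<in> Spec R" if "i \<le> Suc g + r" for i
        using that Q(1) prime[of "i - Suc g"] by (auto simp: C_def Spec_def)
      show "C i \<subset> C (Suc i)" if "i < Suc g + r" for i
      proof -
        consider "i < Suc g" | "i = Suc g" | "i > Suc g" by linarith
        then show ?thesis
        proof cases
          case 1
          then show ?thesis using Q(2) by (simp add: C_def)
        next
          case 2
          then show ?thesis using Q(3) P(2)[of 0] that by (simp add: C_def)
        next
          case 3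
          then have "Suc (i - Suc g) = i - g" by simp
          then show ?thesis using 3 P(2)[of "i - Suc g"] that by (simp add: C_def)
        qed
      qed
    qed
    then show False using assms(3,9) by (simp add: ring_dim_def)
  qed
  have "P i \<in> Supp R E" if "i \<le> r" for i
    using that
  proof (induction i)
    case (Suc i)
    then show ?case
      using Supp_upward_closed[OF E_module _ prime[of "Suc i"], of "P i"] P(2)[of i] by auto
  qed (use \<open>P 0 \<in> Supp R E\<close> in simp)
  then have "ereal (real r) \<le> module_dim R E"
    unfolding module_dim_def using P(2) by (rule krull_dim_ge_chain)
  then show "ereal (real r) \<le> module_dim R (Ext R M (ring_module R) (int d - int r))"
    by (simp add: E_def assms(9))
qed

end
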